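(* Let $R$ be an $n$-dimensional solvable Leibniz algebra over $\mathbb{C}$ whose nilradical $N$ is rigid (in the variety $\mathcal{LN}_s$ of nilpotent Leibniz algebras of dimension $s=\dim N$). Let $R^2=N$, where $R^2=[R,R]$, and suppose that there exists a solvable Leibniz algebra $R_1$ such that $R_1\rightarrow R$. Then $R_1\in\mathcal{LR}_n(N)$, i.e. the nilradical of $R_1$ is isomorphic to $N$.
   Context: All algebras are finite-dimensional over $\mathbb{C}$. A (right) Leibniz algebra is a vector space $L$ with a bilinear bracket satisfying $[x,[y,z]]=[[x,y],z]-[[x,z],y]$ for all $x,y,z\in L$. It is nilpotent if the lower central series $L^1=L$, $L^{k+1}=[L^k,L]$ reaches $0$, and solvable if the derived series reaches $0$. The nilradical is the maximal nilpotent ideal. $n$-dimensional Leibniz algebra structures on $V=\mathbb{C}^n$ form an algebraic subset $\mathcal{L}eib_n$ of the affine variety $\mathrm{Hom}(V\otimes V,V)$; $\mathcal{LN}_n$ and $\mathcal{LR}_n$ denote the subsets of nilpotent, respectively solvable, ones. $\mathrm{GL}_n(\mathbb{C})$ acts by $(g*\lambda)(x,y)=g(\lambda(g^{-1}x,g^{-1}y))$, and the orbits $\mathrm{Orb}(\lambda)$ are the isomorphism classes. For algebras of the same dimension, $\lambda\rightarrow\mu$ ($\lambda$ degenerates to $\mu$) means that $\mathrm{Orb}(\mu)$ lies in the Zariski closure of $\mathrm{Orb}(\lambda)$. A nilpotent Leibniz algebra of dimension $s$ is rigid in $\mathcal{LN}_s$ if its orbit is Zariski open in $\mathcal{LN}_s$.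 $\mathcal{LR}_n(N)$ is the set of all $n$-dimensional solvable Leibniz algebras whose nilradical is (isomorphic to) $N$. *)

theory Defs
  imports "HOL-Analysis.Analysis"
begin

type_synonym 'n bracket = "complex ^ 'n \<Rightarrow> complex ^ 'n \<Rightarrow> complex ^ 'n"

section \<open>Leibniz algebra structures\<close>

definition bilinear_brackets :: "('n::finite) bracket set" where
  "bilinear_brackets = {br.
     (\<forall>y. Vector_Spaces.linear (*s) (*s) (\<lambda>x. br x y)) \<and>
     (\<forall>x. Vector_Spaces.linear (*s) (*s) (br x))}"

definition Leib :: "('n::finite) bracket set" where
  "Leib = {br \<in> bilinear_brackets.
     \<forall>x y z. br x (br y z) = br (br x y) z - br (br x z) y}"

definition bracket_span ::
  "('n::finite) bracket \<Rightarrow> (complex ^ 'n) set \<Rightarrow> (complex ^ 'n) set \<Rightarrow> (complex ^ 'n) set" where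
  "bracket_span br A B = vec.span {br x y | x y. x \<in> A \<and> y \<in> B}"

text \<open>Both series are those of the subalgebra \<open>M\<close>, considered as an algebra in its own right.
  They are indexed from \<open>0\<close>: \<open>lower_central br M k\<close> is the term usually written
  \<open>M\<close> to the power \<open>k + 1\<close>.\<close>

primrec lower_central ::
  "('n::finite) bracket \<Rightarrow> (complex ^ 'n) set \<Rightarrow> nat \<Rightarrow> (complex ^ 'n) set" where
  "lower_central br M 0 = M"
| "lower_central br M (Suc k) = bracket_span br (lower_central br M k) M"

primrec derived_series ::
  "('n::finite) bracket \<Rightarrow> (complex ^ 'n) set \<Rightarrow> nat \<Rightarrow> (complex ^ 'n) set" where
  "derived_series br M 0 = M"
| "derived_series br M (Suc k) = bracket_span br (derived_series br M k) (derived_series br M k)"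

definition nilpotent_alg :: "('n::finite) bracket \<Rightarrow> (complex ^ 'n) set \<Rightarrow> bool" where
  "nilpotent_alg br M \<longleftrightarrow> (\<exists>k. lower_central br M k = {0})"

definition solvable_alg :: "('n::finite) bracket \<Rightarrow> (complex ^ 'n) set \<Rightarrow> bool" where
  "solvable_alg br M \<longleftrightarrow> (\<exists>k. derived_series br M k = {0})"

definition LN :: "('n::finite) bracket set" where
  "LN = {br \<in> Leib. nilpotent_alg br UNIV}"

definition LR :: "('n::finite) bracket set" where
  "LR = {br \<in> Leib. solvable_alg br UNIV}"

definition leibniz_ideal :: "('n::finite) bracket \<Rightarrow> (complex ^ 'n) set \<Rightarrow> bool" where
  "leibniz_ideal br I \<longleftrightarrow> vec.subspace I \<and> (\<forall>x\<in>I. \<forall>y. br x y \<in> I \<and> br y x \<in> I)"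

text \<open>The maximal nilpotent ideal is the one that contains all nilpotent ideals; this determines
  \<open>N\<close> uniquely.\<close>

definition is_nilradical :: "('n::finite) bracket \<Rightarrow> (complex ^ 'n) set \<Rightarrow> bool" where
  "is_nilradical br N \<longleftrightarrow> leibniz_ideal br N \<and> nilpotent_alg br N \<and>
     (\<forall>M. leibniz_ideal br M \<and> nilpotent_alg br M \<longrightarrow> M \<subseteq> N)"

text \<open>Isomorphism between the algebra \<open>M\<close> with bracket \<open>br\<close> and the algebra \<open>M'\<close> with bracket
  \<open>br'\<close>, where \<open>M\<close> and \<open>M'\<close> are subspaces closed under the respective brackets.\<close>

definition alg_iso ::
  "('n::finite) bracket \<Rightarrow> (complex ^ 'n) set \<Rightarrow> ('m::finite) bracket \<Rightarrow> (complex ^ 'm) set \<Rightarrow> bool"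
where
  "alg_iso br M br' M' \<longleftrightarrow> (\<exists>f. bij_betw f M M' \<and>
     (\<forall>x\<in>M. \<forall>y\<in>M. f (x + y) = f x + f y) \<and>
     (\<forall>c. \<forall>x\<in>M. f (c *s x) = c *s f x) \<and>
     (\<forall>x\<in>M. \<forall>y\<in>M. f (br x y) = br' (f x) (f y)))"

text \<open>The solvable structures on \<open>complex ^ 'n\<close> whose nilradical is isomorphic to the algebra
  \<open>N\<close> with bracket \<open>br\<close>.\<close>

definition LR_nil :: "('m::finite) bracket \<Rightarrow> (complex ^ 'm) set \<Rightarrow> ('n::finite) bracket set" where
  "LR_nil br N = {br' \<in> LR. \<exists>M. is_nilradical br' M \<and> alg_iso br' M br N}"

section \<open>The Zariski topology on the space of brackets\<close>

text \<open>Polynomial functions in finitely many of the variables indexed by \<open>'i\<close>.\<close>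

inductive polynomial_fun :: "(('i \<Rightarrow> complex) \<Rightarrow> complex) \<Rightarrow> bool" where
  const: "polynomial_fun (\<lambda>_. c)"
| var: "polynomial_fun (\<lambda>v. v i)"
| add: "polynomial_fun p \<Longrightarrow> polynomial_fun q \<Longrightarrow> polynomial_fun (\<lambda>v. p v + q v)"
| mult: "polynomial_fun p \<Longrightarrow> polynomial_fun q \<Longrightarrow> polynomial_fun (\<lambda>v. p v * q v)"

definition struct_const :: "('n::finite) bracket \<Rightarrow> 'n \<times> 'n \<times> 'n \<Rightarrow> complex" where
  "struct_const br = (\<lambda>(i, j, k). br (axis i 1) (axis j 1) $ k)"

definition zero_locus :: "(('n \<times> 'n \<times> 'n \<Rightarrow> complex) \<Rightarrow> complex) set \<Rightarrow> ('n::finite) bracket set"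
where
  "zero_locus P = {br \<in> bilinear_brackets. \<forall>p\<in>P. p (struct_const br) = 0}"

definition zariski_closed :: "('n::finite) bracket set \<Rightarrow> bool" where
  "zariski_closed S \<longleftrightarrow> (\<exists>P. Ball P polynomial_fun \<and> S = zero_locus P)"

definition zariski :: "('n::finite) bracket topology" where
  "zariski = topology (\<lambda>U. U \<subseteq> bilinear_brackets \<and> zariski_closed (bilinear_brackets - U))"

lemma zariski_closed_Un:
  assumes "zariski_closed S" "zariski_closed T"
  shows "zariski_closed (S \<union> T)"
proof -
  obtain P Q where P: "Ball P polynomial_fun" "S = zero_locus P"
    and Q: "Ball Q polynomial_fun" "T = zero_locus Q"
    using assms unfolding zariski_closed_def by blast
  let ?W = "{\<lambda>v. p v * q v | p q. p \<in> P \<and> q \<in> Q}"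
  have "Ball ?W polynomial_fun"
    using P(1) Q(1) by (auto intro: polynomial_fun.mult)
  moreover have "S \<union> T = zero_locus ?W"
    unfolding P(2) Q(2) zero_locus_def by fastforce
  ultimately show ?thesis
    unfolding zariski_closed_def by blast
qed

lemma zariski_closed_Inter:
  assumes "\<And>S. S \<in> K \<Longrightarrow> zariski_closed S"
  shows "zariski_closed (bilinear_brackets \<inter> \<Inter>K)"
proof -
  let ?W = "\<Union>{P. Ball P polynomial_fun \<and> zero_locus P \<in> K}"
  have "bilinear_brackets \<inter> \<Inter>K = zero_locus ?W"
  proof
    show "bilinear_brackets \<inter> \<Inter>K \<subseteq> zero_locus ?W"
      unfolding zero_locus_def by blast
    show "zero_locus ?W \<subseteq> bilinear_brackets \<inter> \<Inter>K"
    proof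
      fix br assume br: "br \<in> zero_locus ?W"
      have "br \<in> S" if "S \<in> K" for S
      proof -
        obtain P where P: "Ball P polynomial_fun" "S = zero_locus P"
          using assms[OF \<open>S \<in> K\<close>] unfolding zariski_closed_def by blast
        then have "P \<subseteq> ?W"
          using \<open>S \<in> K\<close> by blast
        then show ?thesis
          using br unfolding P(2) zero_locus_def by blast
      qed
      then show "br \<in> bilinear_brackets \<inter> \<Inter>K"
        using br unfolding zero_locus_def by blast
    qed
  qed
  moreover have "Ball ?W polynomial_fun"
    by blast
  ultimately show ?thesis
    unfolding zariski_closed_def by blast
qed

lemma openin_zariski:
  "openin zariski U \<longleftrightarrow> U \<subseteq> bilinear_brackets \<and> zariski_closed (bilinear_brackets - U)"
proof -
  let ?L = "\<lambda>U :: 'a bracket set. U \<subseteq> bilinear_brackets \<and> zariski_closed (bilinear_brackets - U)"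
  have "?L (S \<inter> T)" if "?L S" "?L T" for S T
    using that zariski_closed_Un[of "bilinear_brackets - S" "bilinear_brackets - T"]
    by (auto simp: Diff_Int)
  moreover have "?L (\<Union>K)" if "\<forall>U\<in>K. ?L U" for K
  proof -
    have "bilinear_brackets - \<Union>K = bilinear_brackets \<inter> \<Inter>((\<lambda>U. bilinear_brackets - U) ` K)"
      by blast
    moreover have "zariski_closed (bilinear_brackets \<inter> \<Inter>((\<lambda>U. bilinear_brackets - U) ` K))"
      by (rule zariski_closed_Inter) (use that in auto)
    ultimately show ?thesis
      using that by auto
  qed
  ultimately have "istopology ?L"
    unfolding istopology_def by blast
  then show ?thesis
    unfolding zariski_def by (rule topology_inverse'[THEN fun_cong])
qed

lemma topspace_zariski: "topspace zariski = bilinear_brackets"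
proof
  have "zero_locus {\<lambda>_. 1} = ({} :: 'a bracket set)"
    unfolding zero_locus_def by simp
  then have "zariski_closed ({} :: 'a bracket set)"
    unfolding zariski_closed_def 
    by (intro exI[of _ "{\<lambda>_. 1}"]) (auto intro: polynomial_fun.const)
  then show "(bilinear_brackets :: 'a bracket set) \<subseteq> topspace zariski"
    by (simp add: openin_subset openin_zariski)
  show "topspace zariski \<subseteq> (bilinear_brackets :: 'a bracket set)"
    unfolding topspace_def by (auto simp: openin_zariski)
qed

section \<open>Orbits, degenerations and rigidity\<close>

definition gl_act :: "complex ^ 'n ^ 'n \<Rightarrow> ('n::finite) bracket \<Rightarrow> 'n bracket" where
  "gl_act g br = (\<lambda>x y. g *v br (matrix_inv g *v x) (matrix_inv g *v y))"

definition gl_orbit :: "('n::finite) bracket \<Rightarrow> 'n bracket set" where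
  "gl_orbit br = {gl_act g br | g. invertible g}"

definition degenerates_to :: "('n::finite) bracket \<Rightarrow> 'n bracket \<Rightarrow> bool" where
  "degenerates_to br br' \<longleftrightarrow> gl_orbit br' \<subseteq> zariski closure_of gl_orbit br"

definition rigid_nilpotent :: "('n::finite) bracket \<Rightarrow> bool" where
  "rigid_nilpotent br \<longleftrightarrow> br \<in> LN \<and> openin (subtopology zariski LN) (gl_orbit br)"

end

theory Submission
  imports Defs "HOL-Computational_Algebra.Fundamental_Theorem_Algebra"
begin

text \<open>The proof detects the nilradical by polynomials in the structure constants. Write \<open>\<rho>\<^sub>x\<close> for the right
  multiplication by \<open>x\<close>. By Lie's theorem the right multiplications of a solvable Leibniz algebra
  can be made triangular simultaneously, and the vanishing of all traces of \<open>\<rho>\<^sub>y\<^sup>k \<rho>\<^sub>x\<close>, over all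
  \<open>y\<close> and \<open>k\<close>, then says that \<open>\<rho>\<^sub>x\<close> has zero diagonal. Hence the set of these \<open>x\<close>, the
  trace radical, is the nilradical (\<open>is_nilradical_trace_radical\<close>), and it contains all brackets
  (\<open>bracket_in_trace_radical\<close>).

  Let \<open>s\<close> be the dimension of \<open>N\<close>, which is the derived algebra of \<open>R\<close>.
  Near \<open>R\<close>, in the Zariski topology, two semicontinuity statements hold. The dimension of the trace
  radical is at most \<open>s\<close> (\<open>dim_trace_radical_semicontinuous\<close>), and \<open>s\<close> brackets of coordinate
  vectors that form a basis of \<open>N\<close> at \<open>R\<close> stay independent. For a solvable structure
  near \<open>R\<close> the derived algebra, of dimension at least \<open>s\<close>, therefore fills the nilradical, of
  dimension at most \<open>s\<close>, and the \<open>s\<close> brackets form a basis of both. By Cramer's rule the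
  structure constants of the nilradical in this basis are rational functions of those of the whole
  algebra (\<open>rational_structure_on_derived_algebra\<close>). At \<open>R\<close> these functions give an algebra
  isomorphic to \<open>\<nu>\<close>, so rigidity makes "the nilradical is isomorphic to \<open>\<nu>\<close>" hold wherever one more
  polynomial, obtained by clearing denominators, does not vanish.

  All these polynomials are nonzero at \<open>R\<close>. As \<open>R\<close> lies in the closure of the orbit of \<open>R\<^sub>1\<close>, they are
  nonzero together at some member of that orbit (\<open>degeneration_generic_point\<close>). This member is
  solvable with nilradical isomorphic to \<open>\<nu>\<close>, and it is isomorphic to \<open>R\<^sub>1\<close>.\<close>

section \<open>Eigenvectors modulo an invariant subspace\<close>

text \<open>Otherwise each new term would raise the dimension by one.\<close>
lemma sequence_eventually_dependent:
  fixes v :: "nat \<Rightarrow> 'a::field ^ 'n"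
  shows "\<exists>m. v m \<in> vec.span (W \<union> v ` {..<m})"
proof (rule ccontr)
  assume neg: "\<nexists>m. v m \<in> vec.span (W \<union> v ` {..<m})"
  have "m \<le> vec.dim (W \<union> v ` {..<m})" for m
  proof (induction m)
    case (Suc m)
    have "W \<union> v ` {..<Suc m} = insert (v m) (W \<union> v ` {..<m})"
      by (auto simp: lessThan_Suc)
    then show ?case
      using Suc neg by (auto simp: vec.dim_insert)
  qed auto
  from this[of "Suc CARD('n)"] show False
    using dim_subset_UNIV_cart_gen[of "W \<union> v ` {..<Suc CARD('n)}"] by linarith
qed

lemma span_subset_induct:
  assumes "x \<in> vec.span S" "vec.subspace Q" "\<And>x. x \<in> S \<Longrightarrow> x \<in> Q"
  shows "x \<in> Q"
  using vec.span_minimal[of S Q] assms by blast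

definition poly_apply :: "('a::field ^ 'n \<Rightarrow> 'a ^ 'n) \<Rightarrow> 'a poly \<Rightarrow> 'a ^ 'n \<Rightarrow> 'a ^ 'n" where
  "poly_apply T p u = (\<Sum>i\<le>degree p. coeff p i *s (T ^^ i) u)"

lemma poly_apply_eq_sum:
  assumes "degree p \<le> N"
  shows "poly_apply T p u = (\<Sum>i\<le>N. coeff p i *s (T ^^ i) u)"
  unfolding poly_apply_def using assms
  by (intro sum.mono_neutral_left) (auto simp: coeff_eq_0)

lemma poly_apply_0 [simp]: "poly_apply T 0 u = 0"
  by (simp add: poly_apply_def)

lemma poly_apply_add: "poly_apply T (p + q) u = poly_apply T p u + poly_apply T q u"
proof -
  let ?N = "max (degree p) (degree q)"
  have "degree (p + q) \<le> ?N"
    by (rule degree_add_le_max)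
  then show ?thesis
    by (simp add: poly_apply_eq_sum[of _ ?N] sum.distrib vec.scale_left_distrib)
qed

lemma poly_apply_smult: "poly_apply T (smult c p) u = c *s poly_apply T p u"
  using degree_smult_le[of c p]
  by (simp add: poly_apply_eq_sum[of _ "degree p"] vec.scale_sum_right)

lemma poly_apply_diff: "poly_apply T (p - q) u = poly_apply T p u - poly_apply T q u"
  using poly_apply_add[of T p "smult (-1) q" u] poly_apply_smult[of T "-1" q u] by simp

lemma poly_apply_monom: "poly_apply T (monom 1 m) u = (T ^^ m) u"
proof -
  have "poly_apply T (monom 1 m) u = (\<Sum>i\<le>m. if i = m then (T ^^ i) u else 0)"
    unfolding poly_apply_eq_sum[OF degree_monom_le] by (intro sum.cong) auto
  then show ?thesis
    by simp
qed

lemma poly_apply_pCons_0: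
  assumes "Vector_Spaces.linear (*s) (*s) T"
  shows "poly_apply T (pCons 0 p) u = T (poly_apply T p u)"
proof -
  interpret Vector_Spaces.linear "(*s)" "(*s)" T
    by (rule assms)
  have "degree (pCons 0 p) \<le> Suc (degree p)"
    by (rule degree_pCons_le)
  then have "poly_apply T (pCons 0 p) u = (\<Sum>i\<le>Suc (degree p). coeff (pCons 0 p) i *s (T ^^ i) u)"
    by (rule poly_apply_eq_sum)
  also have "\<dots> = (\<Sum>i\<le>degree p. coeff p i *s T ((T ^^ i) u))"
    by (subst sum.atMost_Suc_shift) simp
  finally show ?thesis
    by (simp add: poly_apply_def sum scale)
qed

text \<open>Working modulo \<open>W\<close> replaces the passage to the quotient by \<open>W\<close>. Take \<open>p\<close> nonzero of least degree
  with \<open>p(T) v\<close> in \<open>W\<close> and split off a linear factor \<open>X - \<mu>\<close>: the remaining factor, applied to \<open>v\<close>,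
  is the eigenvector, and it is outside \<open>W\<close> by minimality.\<close>
lemma eigenvector_mod_subspace:
  fixes T :: "complex ^ 'n \<Rightarrow> complex ^ 'n"
  assumes T: "Vector_Spaces.linear (*s) (*s) T"
    and W: "vec.subspace W" and E: "vec.subspace E" "\<And>u. u \<in> E \<Longrightarrow> T u \<in> E"
    and v: "v \<in> E" "v \<notin> W"
  shows "\<exists>u \<mu>. u \<in> E \<and> u \<notin> W \<and> T u - \<mu> *s u \<in> W"
proof -
  have iter: "(T ^^ i) v \<in> E" for i
    by (induction i) (auto simp: v E)
  have in_E: "poly_apply T p v \<in> E" for p
    unfolding poly_apply_def by (intro vec.subspace_sum vec.subspace_scale E iter)
  obtain m where m: "(T ^^ m) v \<in> vec.span (W \<union> (\<lambda>i. (T ^^ i) v) ` {..<m})"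
    using sequence_eventually_dependent[of "\<lambda>i. (T ^^ i) v" W] by blast
  \<comment> \<open>Modulo \<open>W\<close> the span consists of the \<open>q(T) v\<close> with \<open>q\<close> of degree below \<open>m\<close>, so that the monic
    polynomial \<open>X\<^sup>m - q\<close> sends \<open>v\<close> into \<open>W\<close>.\<close>
  let ?Q = "{x. \<exists>q. (\<forall>i\<ge>m. coeff q i = 0) \<and> x - poly_apply T q v \<in> W}"
  have "x \<in> ?Q" if "x \<in> vec.span (W \<union> (\<lambda>i. (T ^^ i) v) ` {..<m})" for x
    using that
  proof (rule span_subset_induct)
    show "vec.subspace ?Q"
    proof (rule vec.subspaceI)
      show "0 \<in> ?Q"
        using vec.subspace_0[OF W] by (intro CollectI exI[of _ 0]) auto
      show "x + y \<in> ?Q" if xy: "x \<in> ?Q" "y \<in> ?Q" for x y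
      proof -
        obtain p q where pq: "\<forall>i\<ge>m. coeff p i = 0" "x - poly_apply T p v \<in> W"
          "\<forall>i\<ge>m. coeff q i = 0" "y - poly_apply T q v \<in> W"
          using xy by blast
        then have "(x - poly_apply T p v) + (y - poly_apply T q v) \<in> W"
          using vec.subspace_add[OF W] by blast
        then show ?thesis
          using pq by (intro CollectI exI[of _ "p + q"]) (auto simp: poly_apply_add algebra_simps)
      qed
      show "c *s x \<in> ?Q" if x: "x \<in> ?Q" for c x
      proof -
        obtain p where p: "\<forall>i\<ge>m. coeff p i = 0" "x - poly_apply T p v \<in> W"
          using x by blast
        then have "c *s (x - poly_apply T p v) \<in> W"
          using vec.subspace_scale[OF W] by blast
        then show ?thesis
          using p by (intro CollectI exI[of _ "smult c p"])
            (auto simp: poly_apply_smult vec.scale_right_diff_distrib)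
      qed
    qed
    show "x \<in> ?Q" if "x \<in> W \<union> (\<lambda>i. (T ^^ i) v) ` {..<m}" for x
      using that
    proof
      assume "x \<in> W"
      then show ?thesis
        by (intro CollectI exI[of _ 0]) auto
    next
      assume "x \<in> (\<lambda>i. (T ^^ i) v) ` {..<m}"
      then obtain i where "i < m" "x = (T ^^ i) v"
        by blast
      then show ?thesis
        using vec.subspace_0[OF W] by (intro CollectI exI[of _ "monom 1 i"]) (auto simp: poly_apply_monom)
    qed
  qed
  then obtain q where q: "\<forall>i\<ge>m. coeff q i = 0" "(T ^^ m) v - poly_apply T q v \<in> W"
    using m by blast
  have "coeff (monom 1 m - q) m = 1"
    using q by simp
  then have "monom 1 m - q \<noteq> 0"
    by (metis coeff_0 zero_neq_one)
  moreover have "poly_apply T (monom 1 m - q) v \<in> W"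
    using q by (simp add: poly_apply_diff poly_apply_monom)
  ultimately have "\<exists>d p. p \<noteq> 0 \<and> poly_apply T p v \<in> W \<and> degree p = d"
    by blast
  then obtain d where d: "\<exists>p. p \<noteq> 0 \<and> poly_apply T p v \<in> W \<and> degree p = d"
    and min: "\<And>e. e < d \<Longrightarrow> \<not> (\<exists>p. p \<noteq> 0 \<and> poly_apply T p v \<in> W \<and> degree p = e)"
    using exists_least_iff[of "\<lambda>d. \<exists>p. p \<noteq> 0 \<and> poly_apply T p v \<in> W \<and> degree p = d"] by blast
  then obtain p where p: "p \<noteq> 0" "poly_apply T p v \<in> W" "degree p = d"
    by blast
  have "degree p \<noteq> 0"
  proof
    assume "degree p = 0"
    then obtain a where a: "p = [:a:]"
      by (metis degree_eq_zeroE)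
    then have "a \<noteq> 0" "a *s v \<in> W"
      using p by (auto simp: poly_apply_def)
    then have "inverse a *s (a *s v) \<in> W"
      using vec.subspace_scale[OF W] by blast
    then show False
      using \<open>a \<noteq> 0\<close> v by simp
  qed
  then have "\<not> constant (poly p)"
    by (simp add: constant_degree)
  then obtain \<mu> where "poly p \<mu> = 0"
    using fundamental_theorem_of_algebra by blast
  then obtain q where q: "p = [:-\<mu>, 1:] * q"
    by (auto simp: poly_eq_0_iff_dvd dvd_def)
  then have "q \<noteq> 0"
    using p by auto
  then have "degree p = Suc (degree q)"
    unfolding q by (subst degree_mult_eq) auto
  then have "poly_apply T q v \<notin> W"
    using min[of "degree q"] p \<open>q \<noteq> 0\<close> by auto
  moreover have "p = pCons 0 q - smult \<mu> q"
    by (simp add: q)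
  then have "poly_apply T p v = T (poly_apply T q v) - \<mu> *s poly_apply T q v"
    by (simp add: poly_apply_diff poly_apply_smult poly_apply_pCons_0[OF T])
  ultimately show ?thesis
    using p in_E by metis
qed

section \<open>Lie's theorem for solvable Leibniz algebras\<close>

locale bilinear_bracket =
  fixes br :: "('n::finite) bracket"
  assumes bilinear: "br \<in> bilinear_brackets"
begin

lemma linear_left: "Vector_Spaces.linear (*s) (*s) (\<lambda>x. br x y)"
  and linear_right: "Vector_Spaces.linear (*s) (*s) (br x)"
  using bilinear by (auto simp: bilinear_brackets_def)

lemma add_left: "br (x + y) z = br x z + br y z"
  and add_right: "br x (y + z) = br x y + br x z"
  and scale_left: "br (c *s x) y = c *s br x y"
  and scale_right: "br x (c *s y) = c *s br x y"
  and diff_left: "br (x - y) z = br x z - br y z"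
  and diff_right: "br x (y - z) = br x y - br x z"
  and zero_left [simp]: "br 0 y = 0"
  and zero_right [simp]: "br x 0 = 0"
  and sum_left: "br (sum f I) y = (\<Sum>i\<in>I. br (f i) y)"
  and sum_right: "br x (sum f I) = (\<Sum>i\<in>I. br x (f i))"
proof -
  interpret l: Vector_Spaces.linear "(*s)" "(*s)" "\<lambda>x. br x y" for y
    by (rule linear_left)
  interpret r: Vector_Spaces.linear "(*s)" "(*s)" "br x" for x
    by (rule linear_right)
  show "br (x + y) z = br x z + br y z" "br x (y + z) = br x y + br x z"
    "br (c *s x) y = c *s br x y" "br x (c *s y) = c *s br x y"
    "br (x - y) z = br x z - br y z" "br x (y - z) = br x y - br x z"
    "br 0 y = 0" "br x 0 = 0"
    "br (sum f I) y = (\<Sum>i\<in>I. br (f i) y)" "br x (sum f I) = (\<Sum>i\<in>I. br x (f i))"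
    by (simp_all add: l.add r.add l.scale r.scale l.diff r.diff l.sum r.sum)
qed

end

locale leibniz = bilinear_bracket br for br :: "('n::finite) bracket" +
  assumes leibniz: "br x (br y z) = br (br x y) z - br (br x z) y"

lemma leibniz_iff: "leibniz br \<longleftrightarrow> br \<in> Leib"
  by (auto simp: leibniz_def leibniz_axioms_def bilinear_bracket_def Leib_def)

lemma bracket_span_subset:
  assumes "vec.subspace M" "\<And>x y. x \<in> A \<Longrightarrow> y \<in> B \<Longrightarrow> br x y \<in> M"
  shows "bracket_span br A B \<subseteq> M"
  unfolding bracket_span_def by (rule vec.span_minimal) (use assms in auto)

lemma bracket_in_span: "x \<in> A \<Longrightarrow> y \<in> B \<Longrightarrow> br x y \<in> bracket_span br A B"
  unfolding bracket_span_def by (intro vec.span_base) auto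

lemma subspace_bracket_span: "vec.subspace (bracket_span br A B)"
  by (simp add: bracket_span_def)

lemma subspace_derived_series:
  "vec.subspace (derived_series br UNIV k)"
  by (cases k) (auto simp: subspace_bracket_span)

lemma derived_series_Suc_subset: "derived_series br UNIV (Suc k) \<subseteq> derived_series br UNIV k"
proof (induction k)
  case (Suc k)
  then show ?case
    unfolding derived_series.simps(2)
    by (intro bracket_span_subset subspace_bracket_span bracket_in_span) auto
qed auto

context leibniz
begin

text \<open>This is the characteristic zero step of Lie's theorem. Put \<open>e\<^sub>i = \<rho>\<^sub>z\<^sup>i v\<close> and let \<open>E\<^sub>i\<close> be \<open>W\<close> plus the
  span of \<open>e\<^sub>0, \<dots>, e\<^sub>i\<^sub>-\<^sub>1\<close>. On the \<open>E\<^sub>i\<close>, \<open>\<rho>\<^sub>h\<close> acts triangularly with diagonal entry \<open>lam h\<close>. Instead of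
  comparing traces on the final term of the chain, the proof follows the entry just above the
  diagonal: modulo \<open>E\<^sub>i\<^sub>-\<^sub>1\<close>, the vector \<open>\<rho>\<^sub>h e\<^sub>i - lam h e\<^sub>i\<close> is \<open>- i lam [h,z] e\<^sub>i\<^sub>-\<^sub>1\<close>. At the first \<open>m\<close> with
  \<open>e\<^sub>m\<close> in \<open>E\<^sub>m\<close> it must vanish, hence \<open>m lam [h,z] = 0\<close>.\<close>
lemma weight_invariance:
  assumes W: "vec.subspace W" "\<And>w y. w \<in> W \<Longrightarrow> br w y \<in> W" and v: "v \<notin> W"
    and H: "\<And>h. h \<in> H \<Longrightarrow> br h z \<in> H"
    and weight: "\<And>h. h \<in> H \<Longrightarrow> br v h - lam h *s v \<in> W"
    and "h \<in> H"
  shows "lam (br h z) = 0"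
proof -
  define e where "e i = ((\<lambda>u. br u z) ^^ i) v" for i
  define E where "E i = vec.span (W \<union> e ` {..<i})" for i
  have e_Suc: "e (Suc i) = br (e i) z" for i
    by (simp add: e_def)
  have E_0: "E 0 = W"
    using W by (simp add: E_def vec.span_eq_iff)
  have sub_E: "vec.subspace (E i)" for i
    by (simp add: E_def)
  have E_mono: "E i \<subseteq> E j" if "i \<le> j" for i j
    unfolding E_def using that by (intro vec.span_mono) auto
  have W_E: "W \<subseteq> E i" for i
    using E_mono[of 0 i] E_0 by simp
  have e_E: "e i \<in> E j" if "i < j" for i j
    unfolding E_def using that by (intro vec.span_base) auto
  have z_E: "br u z \<in> E (Suc i)" if "u \<in> E i" for u i
  proof -
    have "u \<in> vec.span (W \<union> e ` {..<i})"
      using that by (simp add: E_def)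
    then have "u \<in> {x. br x z \<in> E (Suc i)}"
    proof (rule span_subset_induct)
      show "vec.subspace {x. br x z \<in> E (Suc i)}"
        by (rule vec.subspaceI)
          (auto simp: add_left scale_left vec.subspace_0 vec.subspace_add vec.subspace_scale sub_E)
      show "x \<in> {x. br x z \<in> E (Suc i)}" if "x \<in> W \<union> e ` {..<i}" for x
        using that W(2) W_E[of "Suc i"] e_E[of _ "Suc i"] by (auto simp flip: e_Suc)
    qed
    then show ?thesis
      by simp
  qed
  \<comment> \<open>For \<open>i = 0\<close> the index \<open>i - 1\<close> is again \<open>0\<close>: the last summand has coefficient zero and \<open>E 0 = W\<close>,
    so that the formula is the hypothesis on \<open>v\<close>.\<close>
  have key: "\<forall>h\<in>H. br (e i) h - lam h *s e i + (of_nat i * lam (br h z)) *s e (i - 1) \<in> E (i - 1)" for i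
  proof (induction i)
    case 0
    then show ?case
      using weight by (auto simp: e_def E_0)
  next
    case (Suc i)
    show ?case
    proof
      fix h assume h: "h \<in> H"
      let ?d = "br (e i) h - lam h *s e i + (of_nat i * lam (br h z)) *s e (i - 1)"
      let ?d' = "br (e i) (br h z) - lam (br h z) *s e i"
      have "br ?d z \<in> E i"
      proof (cases i)
        case 0
        then show ?thesis
          using Suc h W E_0 by auto
      next
        case (Suc j)
        have "?d \<in> E j"
          using Suc.IH h Suc by auto
        then show ?thesis
          using z_E Suc by auto
      qed
      moreover have "?d' \<in> E i"
      proof (cases i)
        case 0
        then show ?thesis
          using weight[OF H[OF h]] by (simp add: e_def E_0)
      next
        case (Suc j)
        let ?a = "of_nat i * lam (br (br h z) z)"
        have "?d' + ?a *s e j \<in> E j"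
          using Suc.IH H[OF h] Suc by auto
        then have "?d' + ?a *s e j \<in> E i"
          using E_mono[of j i] Suc by auto
        moreover have "?a *s e j \<in> E i"
          using e_E[of j i] Suc sub_E vec.subspace_scale by blast
        ultimately have "(?d' + ?a *s e j) - ?a *s e j \<in> E i"
          using sub_E vec.subspace_diff by blast
        then show ?thesis
          by simp
      qed
      ultimately have "br ?d z - ?d' \<in> E i"
        using sub_E vec.subspace_diff by blast
      \<comment> \<open>The difference of the two members of \<open>E i\<close> is the vector required for \<open>Suc i\<close>, by the Leibniz
        identity for \<open>e i\<close>, \<open>h\<close>, \<open>z\<close>.\<close>
      moreover have "(of_nat i * lam (br h z)) *s e (Suc (i - 1)) = (of_nat i * lam (br h z)) *s e i"
        by (cases i) auto
      then have "br ?d z - ?d' = br (br (e i) h) z - br (e i) (br h z) - lam h *s e (Suc i)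
          + (of_nat (Suc i) * lam (br h z)) *s e i"
        by (simp add: add_left diff_left scale_left flip: e_Suc) (simp add: algebra_simps)
      moreover have "br (br (e i) h) z - br (e i) (br h z) = br (e (Suc i)) h"
        by (simp add: leibniz e_Suc)
      ultimately show "br (e (Suc i)) h - lam h *s e (Suc i) + (of_nat (Suc i) * lam (br h z)) *s e (Suc i - 1) \<in> E (Suc i - 1)"
        by simp
    qed
  qed
  have lower: "br (e i) h - lam h *s e i \<in> E i" for i
  proof (cases i)
    case 0
    then show ?thesis
      using key[of 0] \<open>h \<in> H\<close> by auto
  next
    case (Suc j)
    have "br (e i) h - lam h *s e i + (of_nat i * lam (br h z)) *s e j \<in> E i"
      using key[of i] \<open>h \<in> H\<close> Suc E_mono[of j i] by auto
    moreover have "(of_nat i * lam (br h z)) *s e j \<in> E i"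
      using e_E[of j i] Suc sub_E vec.subspace_scale by blast
    ultimately show ?thesis
      using sub_E vec.subspace_diff by fastforce
  qed
  have E_h: "br u h - lam h *s u \<in> E i" if "u \<in> E (Suc i)" for u i
  proof -
    have "u \<in> vec.span (W \<union> e ` {..<Suc i})"
      using that by (simp add: E_def)
    then have "u \<in> {u. br u h - lam h *s u \<in> E i}"
    proof (rule span_subset_induct)
      show "vec.subspace {u. br u h - lam h *s u \<in> E i}"
      proof (rule vec.subspaceI)
        show "x + y \<in> {u. br u h - lam h *s u \<in> E i}"
          if "x \<in> {u. br u h - lam h *s u \<in> E i}" "y \<in> {u. br u h - lam h *s u \<in> E i}" for x y
        proof -
          have "(br x h - lam h *s x) + (br y h - lam h *s y) \<in> E i"
            using that by (intro vec.subspace_add sub_E) auto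
          then show ?thesis
            by (simp add: add_left algebra_simps)
        qed
        show "c *s x \<in> {u. br u h - lam h *s u \<in> E i}"
          if "x \<in> {u. br u h - lam h *s u \<in> E i}" for c x
        proof -
          have "c *s (br x h - lam h *s x) \<in> E i"
            using that by (intro vec.subspace_scale sub_E) auto
          then show ?thesis
            by (simp add: scale_left algebra_simps)
        qed
      qed (auto simp: vec.subspace_0 sub_E)
      show "x \<in> {u. br u h - lam h *s u \<in> E i}" if "x \<in> W \<union> e ` {..<Suc i}" for x
        using that
      proof
        assume "x \<in> W"
        then have "br x h - lam h *s x \<in> W"
          using W vec.subspace_diff vec.subspace_scale by blast
        then show ?thesis
          using W_E by blast
      next
        assume "x \<in> e ` {..<Suc i}"
        then obtain j where "j \<le> i" "x = e j"
          using less_Suc_eq_le by blast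
        then show ?thesis
          using lower[of j] E_mono[of j i] by auto
      qed
    qed
    then show ?thesis
      by simp
  qed
  obtain m where m: "e m \<in> E m" and min: "\<And>j. j < m \<Longrightarrow> e j \<notin> E j"
    using sequence_eventually_dependent[of e W] exists_least_iff[of "\<lambda>m. e m \<in> E m"]
    unfolding E_def by blast
  have "m \<noteq> 0"
    using m v E_0 by (metis e_def funpow_0)
  then obtain j where j: "m = Suc j"
    using not0_implies_Suc by blast
  let ?a = "of_nat m * lam (br h z)"
  have "br (e m) h - lam h *s e m + ?a *s e j \<in> E j"
    using key[of m] \<open>h \<in> H\<close> j by auto
  moreover have "br (e m) h - lam h *s e m \<in> E j"
    using E_h[of "e m" j] m j by auto
  ultimately have "?a *s e j \<in> E j"
    using sub_E vec.subspace_diff by fastforce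
  have "?a = 0"
  proof (rule ccontr)
    assume "?a \<noteq> 0"
    have "inverse ?a *s (?a *s e j) \<in> E j"
      using \<open>?a *s e j \<in> E j\<close> sub_E vec.subspace_scale by blast
    then have "(inverse ?a * ?a) *s e j \<in> E j"
      by (simp only: vec.scale_scale)
    then have "e j \<in> E j"
      using left_inverse[OF \<open>?a \<noteq> 0\<close>] by (simp only: vec.scale_one)
    then show False
      using min[of j] j by simp
  qed
  then show ?thesis
    using \<open>m \<noteq> 0\<close> by (simp only: mult_eq_0_iff of_nat_eq_0_iff) simp
qed

end

context leibniz
begin

text \<open>The set of vectors on which \<open>vec.span A\<close> acts modulo \<open>W\<close> by the weight \<open>lam\<close> is invariant under \<open>\<rho>\<^sub>z\<close>,
  because the weight vanishes on \<open>[h,z]\<close> for \<open>h\<close> in \<open>vec.span A\<close>. So \<open>\<rho>\<^sub>z\<close> has an eigenvector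
  in it modulo \<open>W\<close>.\<close>
lemma common_eigenvector_extend:
  assumes W: "vec.subspace W" "\<And>w y. w \<in> W \<Longrightarrow> br w y \<in> W"
    and commutators: "\<And>x y. x \<in> vec.span (insert z A) \<Longrightarrow> y \<in> vec.span (insert z A) \<Longrightarrow> br x y \<in> vec.span A"
    and ev: "\<exists>v. v \<notin> W \<and> (\<forall>h\<in>vec.span A. \<exists>c. br v h - c *s v \<in> W)"
  shows "\<exists>v. v \<notin> W \<and> (\<forall>h\<in>vec.span (insert z A). \<exists>c. br v h - c *s v \<in> W)"
proof -
  obtain v lam where v: "v \<notin> W" and lam: "\<And>h. h \<in> vec.span A \<Longrightarrow> br v h - lam h *s v \<in> W"
    using ev by metis
  have A_sub: "vec.span A \<subseteq> vec.span (insert z A)"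
    by (intro vec.span_mono) auto
  have z: "z \<in> vec.span (insert z A)"
    by (intro vec.span_base) auto
  have H: "br h z \<in> vec.span A" if "h \<in> vec.span A" for h
    using commutators[OF _ z] that A_sub by blast
  have lam_0: "lam (br h z) = 0" if "h \<in> vec.span A" for h
    using weight_invariance[OF W v, where H = "vec.span A"] H lam that by blast
  define E where "E = {u. \<forall>h\<in>vec.span A. br u h - lam h *s u \<in> W}"
  have "vec.subspace E"
  proof (rule vec.subspaceI)
    show "0 \<in> E"
      using W(1) by (simp add: E_def vec.subspace_0)
    show "x + y \<in> E" if "x \<in> E" "y \<in> E" for x y
    proof -
      have "(br x h - lam h *s x) + (br y h - lam h *s y) \<in> W" if "h \<in> vec.span A" for h
        using \<open>x \<in> E\<close> \<open>y \<in> E\<close> that by (intro vec.subspace_add W) (auto simp: E_def)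
      then show ?thesis
        by (simp add: E_def add_left algebra_simps)
    qed
    show "c *s x \<in> E" if "x \<in> E" for c x
    proof -
      have "c *s (br x h - lam h *s x) \<in> W" if "h \<in> vec.span A" for h
        using \<open>x \<in> E\<close> that by (intro vec.subspace_scale W) (auto simp: E_def)
      then show ?thesis
        by (simp add: E_def scale_left algebra_simps)
    qed
  qed
  moreover have "br u z \<in> E" if u: "u \<in> E" for u
    unfolding E_def
  proof (intro CollectI ballI)
    fix h assume h: "h \<in> vec.span A"
    have "br (br u h - lam h *s u) z \<in> W" "br u (br h z) - lam (br h z) *s u \<in> W"
      using u h H W(2) by (auto simp: E_def)
    then have "br (br u h - lam h *s u) z - (br u (br h z) - lam (br h z) *s u) \<in> W"
      using W(1) vec.subspace_diff by blast
    then show "br (br u z) h - lam h *s br u z \<in> W"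
      by (simp add: leibniz[of u h z] lam_0[OF h] diff_left scale_left algebra_simps)
  qed
  moreover have "v \<in> E"
    using lam by (simp add: E_def)
  ultimately obtain u \<mu> where u: "u \<in> E" "u \<notin> W" "br u z - \<mu> *s u \<in> W"
    using eigenvector_mod_subspace[OF linear_left[of z] W(1), of E v] v by blast
  have "\<exists>c. br u h - c *s u \<in> W" if "h \<in> vec.span (insert z A)" for h
  proof -
    obtain k where k: "h - k *s z \<in> vec.span A"
      using \<open>h \<in> vec.span (insert z A)\<close> vec.span_breakdown_eq by blast
    let ?h = "h - k *s z"
    have "(br u ?h - lam ?h *s u) + k *s (br u z - \<mu> *s u) \<in> W"
      using u k by (intro vec.subspace_add vec.subspace_scale W) (auto simp: E_def)
    then have "br u h - (lam ?h + k * \<mu>) *s u \<in> W"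
      by (simp add: diff_right scale_right algebra_simps)
    then show ?thesis
      by blast
  qed
  then show ?thesis
    using u by blast
qed

text \<open>Lie's theorem. The induction climbs from the zero end of the derived series to the whole algebra,
  adding one vector at a time: any subspace between two consecutive terms of the series has its brackets
  in the smaller term.\<close>
theorem common_eigenvector:
  assumes solv: "solvable_alg br UNIV"
    and W: "vec.subspace W" "\<And>w y. w \<in> W \<Longrightarrow> br w y \<in> W" "W \<noteq> UNIV"
  shows "\<exists>v. v \<notin> W \<and> (\<forall>h. \<exists>c. br v h - c *s v \<in> W)"
proof -
  let ?D = "derived_series br UNIV"
  obtain k where k: "?D k = {0}"
    using solv unfolding solvable_alg_def by blast
  have "\<exists>v. v \<notin> W \<and> (\<forall>h\<in>?D 0. \<exists>c. br v h - c *s v \<in> W)"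
  proof (rule inc_induct[of 0 k])
    obtain v where "v \<notin> W"
      using W(3) by auto
    moreover have "br v h - 0 *s v \<in> W" if "h \<in> ?D k" for h
      using that k W(1) by (simp add: vec.subspace_0)
    ultimately show "\<exists>v. v \<notin> W \<and> (\<forall>h\<in>?D k. \<exists>c. br v h - c *s v \<in> W)"
      by (intro exI[of _ v] conjI ballI exI[of _ 0]) auto
  next
    fix j assume IH: "\<exists>v. v \<notin> W \<and> (\<forall>h\<in>?D (Suc j). \<exists>c. br v h - c *s v \<in> W)"
    obtain B where B: "B \<subseteq> ?D j" "vec.independent B" "?D j \<subseteq> vec.span B"
      by (rule vec.basis_exists[of "?D j"])
    have D_sub: "vec.subspace (?D i)" for i
      by (rule subspace_derived_series)
    have "\<exists>v. v \<notin> W \<and> (\<forall>h\<in>vec.span (F \<union> ?D (Suc j)). \<exists>c. br v h - c *s v \<in> W)"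
      if "finite F" "F \<subseteq> B" for F
      using that
    proof (induction F)
      case empty
      then show ?case
        using IH D_sub[of "Suc j"] by (simp add: vec.span_eq_iff[THEN iffD2])
    next
      case (insert z F)
      have "vec.span (insert z (F \<union> ?D (Suc j))) \<subseteq> ?D j"
        using insert.prems B(1) derived_series_Suc_subset[of br j]
        by (intro vec.span_minimal D_sub) auto
      then have in_D: "br x y \<in> ?D (Suc j)"
        if "x \<in> vec.span (insert z (F \<union> ?D (Suc j)))" "y \<in> vec.span (insert z (F \<union> ?D (Suc j)))" for x y
        using that unfolding derived_series.simps(2) by (intro bracket_in_span) auto
      have "?D (Suc j) \<subseteq> vec.span (F \<union> ?D (Suc j))"
        using vec.span_superset[of "F \<union> ?D (Suc j)"] by blast
      with in_D show ?case
        unfolding Un_insert_left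
        by (intro common_eigenvector_extend[OF W(1,2)] insert.IH) (use insert.prems in blast)+
    qed
    from this[OF vec.finiteI_independent[OF B(2)] order.refl]
    have "\<exists>v. v \<notin> W \<and> (\<forall>h\<in>vec.span (B \<union> ?D (Suc j)). \<exists>c. br v h - c *s v \<in> W)" .
    then obtain v where v: "v \<notin> W"
      "\<And>h. h \<in> vec.span (B \<union> ?D (Suc j)) \<Longrightarrow> \<exists>c. br v h - c *s v \<in> W"
      by auto
    have "?D j \<subseteq> vec.span (B \<union> ?D (Suc j))"
      by (rule order.trans[OF B(3) vec.span_mono]) simp
    then show "\<exists>v. v \<notin> W \<and> (\<forall>h\<in>?D j. \<exists>c. br v h - c *s v \<in> W)"
      using v by (intro exI[of _ v] conjI ballI) auto
  qed auto
  then show ?thesis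
    by simp
qed

text \<open>A common eigenvector modulo the span of its predecessors is chosen at every step.\<close>
lemma triangular_basis:
  assumes solv: "solvable_alg br UNIV"
  obtains b :: "nat \<Rightarrow> complex ^ 'n"
    where "\<And>k. k < CARD('n) \<Longrightarrow> b k \<notin> vec.span (b ` {..<k})"
      and "\<And>k y. k < CARD('n) \<Longrightarrow> \<exists>c. br (b k) y - c *s b k \<in> vec.span (b ` {..<k})"
proof -
  define ev where "ev W = (SOME v. v \<notin> W \<and> (\<forall>h. \<exists>c. br v h - c *s v \<in> W))" for W
  define F where "F = rec_nat {0} (\<lambda>_ W. vec.span (insert (ev W) W))"
  define b where "b k = ev (F k)" for k
  have F_0: "F 0 = {0}" and F_Suc: "F (Suc k) = vec.span (insert (b k) (F k))" for k
    by (simp_all add: F_def b_def)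
  have F_span: "F k = vec.span (b ` {..<k})" for k
  proof (induction k)
    case (Suc k)
    have "vec.span (insert (b k) (vec.span (b ` {..<k}))) = vec.span (insert (b k) (b ` {..<k}))"
      by (simp add: vec.span_insert vec.span_span)
    then show ?case
      by (simp add: F_Suc Suc lessThan_Suc)
  qed (simp add: F_0)
  have sub: "vec.subspace (F k)" for k
    by (simp add: F_span)
  have proper: "F k \<noteq> UNIV" if "k < CARD('n)" for k
  proof
    assume "F k = UNIV"
    then have "vec.dim (b ` {..<k}) = CARD('n)"
      by (metis F_span vec.dim_span vec_dim_card)
    then show False
      using vec.dim_le_card'[of "b ` {..<k}"] card_image_le[of "{..<k}" b] that by simp
  qed
  have b: "b k \<notin> F k \<and> (\<forall>h. \<exists>c. br (b k) h - c *s b k \<in> F k)"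
    if inv: "\<And>w y. w \<in> F k \<Longrightarrow> br w y \<in> F k" and "k < CARD('n)" for k
    unfolding b_def ev_def
    by (rule someI_ex) (use common_eigenvector[OF solv sub inv proper[OF that(2)]] in blast)
  have inv: "k \<le> CARD('n) \<Longrightarrow> (\<forall>w\<in>F k. \<forall>y. br w y \<in> F k)" for k
  proof (induction k)
    case 0
    then show ?case
      by (simp add: F_0)
  next
    case (Suc k)
    then have IH: "\<And>w y. w \<in> F k \<Longrightarrow> br w y \<in> F k" and k: "k < CARD('n)"
      by auto
    have mono: "F k \<subseteq> F (Suc k)"
      unfolding F_Suc using vec.span_superset[of "insert (b k) (F k)"] by blast
    have bk: "b k \<in> F (Suc k)"
      unfolding F_Suc by (intro vec.span_base) auto
    show ?case
    proof (intro ballI allI)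
      fix w y assume "w \<in> F (Suc k)"
      then obtain c where c: "w - c *s b k \<in> F k"
        unfolding F_Suc vec.span_breakdown_eq using sub[of k] by (auto simp: vec.span_eq_iff[THEN iffD2])
      obtain d where d: "br (b k) y - d *s b k \<in> F k"
        using b[OF IH k] by blast
      have "br (w - c *s b k) y + c *s (br (b k) y - d *s b k) + (c * d) *s b k \<in> F (Suc k)"
        using mono bk IH[OF c, of y] d
        by (intro vec.subspace_add vec.subspace_scale sub) auto
      then show "br w y \<in> F (Suc k)"
        by (simp add: diff_left scale_left algebra_simps)
    qed
  qed
  show thesis
  proof (rule that[of b])
    fix k y assume k: "k < CARD('n)"
    then have "\<And>w y. w \<in> F k \<Longrightarrow> br w y \<in> F k"
      using inv[of k] by auto
    from b[OF this k] show "b k \<notin> vec.span (b ` {..<k})"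
      "\<exists>c. br (b k) y - c *s b k \<in> vec.span (b ` {..<k})"
      by (auto simp flip: F_span)
  qed
qed

end

section \<open>The nilradical as a radical of trace forms\<close>

definition right_mult :: "('n::finite) bracket \<Rightarrow> complex ^ 'n \<Rightarrow> complex ^ 'n ^ 'n" where
  "right_mult br y = matrix (\<lambda>x. br x y)"

definition trace_form :: "('n::finite) bracket \<Rightarrow> complex ^ 'n \<Rightarrow> nat \<Rightarrow> complex ^ 'n \<Rightarrow> complex" where
  "trace_form br y k x = trace (((**) (right_mult br y) ^^ k) (right_mult br x))"

text \<open>Using all powers of \<open>\<rho>\<^sub>y\<close>, and not only the bilinear form \<open>tr (\<rho>\<^sub>y \<rho>\<^sub>x)\<close>, is essential:
  over the complex numbers weights can be nonzero while the sum of their squares vanishes.\<close>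
definition trace_radical :: "('n::finite) bracket \<Rightarrow> (complex ^ 'n) set" where
  "trace_radical br = {x. \<forall>y k. trace_form br y k x = 0}"

text \<open>An index type such as \<open>'n\<close> carries no order; \<open>h\<close> numbers the basis vectors in the order of the flag.\<close>
definition upper_triangular_wrt :: "('n::finite \<Rightarrow> nat) \<Rightarrow> complex ^ 'n ^ 'n \<Rightarrow> bool" where
  "upper_triangular_wrt h A \<longleftrightarrow> (\<forall>i j. h j < h i \<longrightarrow> A $ i $ j = 0)"

lemma upper_triangular_wrt_mult:
  assumes "inj h" "upper_triangular_wrt h A" "upper_triangular_wrt h B"
  shows "upper_triangular_wrt h (A ** B)"
    and "(A ** B) $ i $ i = A $ i $ i * B $ i $ i"
proof -
  have zero: "A $ i $ k * B $ k $ j = 0" if "h k < h i \<or> h j < h k" for i j k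
    using that assms by (auto simp: upper_triangular_wrt_def)
  have "A $ i $ k * B $ k $ j = 0" if "h j < h i" for i j k
    by (rule zero) (use that in linarith)
  then have "(A ** B) $ i $ j = 0" if "h j < h i" for i j
    unfolding matrix_matrix_mult_def vec_lambda_beta using that by (intro sum.neutral ballI) auto
  then show "upper_triangular_wrt h (A ** B)"
    by (simp add: upper_triangular_wrt_def)
  have "A $ i $ k * B $ k $ i = (if k = i then A $ i $ i * B $ i $ i else 0)" for k
  proof (cases "k = i")
    case False
    then have "h k < h i \<or> h i < h k"
      using injD[OF assms(1), of k i] by (metis linorder_neqE_nat)
    then show ?thesis
      using zero[of k i i] False by simp
  qed simp
  then have "(A ** B) $ i $ i = (\<Sum>k\<in>UNIV. if k = i then A $ i $ i * B $ i $ i else 0)"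
    unfolding matrix_matrix_mult_def vec_lambda_beta by (intro sum.cong refl)
  then show "(A ** B) $ i $ i = A $ i $ i * B $ i $ i"
    by simp
qed

lemma upper_triangular_wrt_power_mult:
  assumes "inj h" "upper_triangular_wrt h A" "upper_triangular_wrt h B"
  shows "upper_triangular_wrt h (((**) A ^^ k) B) \<and> ((**) A ^^ k) B $ i $ i = (A $ i $ i) ^ k * B $ i $ i"
  using assms by (induction k) (auto simp: upper_triangular_wrt_mult)

lemma conjugate_power_mult:
  fixes P Q A B :: "'a::comm_semiring_1 ^ 'n ^ 'n"
  assumes "P ** Q = mat 1"
  shows "Q ** (((**) A ^^ k) B) ** P = ((**) (Q ** A ** P) ^^ k) (Q ** B ** P)"
proof (induction k)
  case (Suc k)
  have "Q ** (A ** (((**) A ^^ k) B)) ** P = Q ** A ** (P ** Q) ** (((**) A ^^ k) B) ** P"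
    using assms by (simp add: matrix_mul_assoc)
  also have "\<dots> = (Q ** A ** P) ** (Q ** (((**) A ^^ k) B) ** P)"
    by (simp only: matrix_mul_assoc)
  finally show ?case
    using Suc by simp
qed auto

lemma trace_conjugate:
  fixes P Q A :: "'a::comm_semiring_1 ^ 'n ^ 'n"
  assumes "P ** Q = mat 1"
  shows "trace (Q ** A ** P) = trace A"
proof -
  have "trace (Q ** A ** P) = trace (P ** (Q ** A))"
    by (rule trace_mul_sym)
  then show ?thesis
    using assms by (simp add: matrix_mul_assoc)
qed

text \<open>All \<open>\<Sum>i. z i * p (z i)\<close> vanish, for every polynomial \<open>p\<close>. If \<open>z a\<close> were nonzero, the polynomial with
  the other values of \<open>z\<close> as its roots would give a nonzero sum.\<close>
lemma power_sums_zero_imp_zero: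
  fixes z :: "'i \<Rightarrow> complex"
  assumes I: "finite I" and sums: "\<And>k. (\<Sum>i\<in>I. z i ^ Suc k) = 0" and "a \<in> I"
  shows "z a = 0"
proof (rule ccontr)
  assume a: "z a \<noteq> 0"
  have poly_sum: "(\<Sum>i\<in>I. z i * poly p (z i)) = 0" for p
  proof -
    have "(\<Sum>i\<in>I. z i * poly p (z i)) = (\<Sum>i\<in>I. \<Sum>j\<le>degree p. coeff p j * z i ^ Suc j)"
      by (simp add: poly_altdef sum_distrib_left mult_ac)
    also have "\<dots> = (\<Sum>j\<le>degree p. coeff p j * (\<Sum>i\<in>I. z i ^ Suc j))"
      by (subst sum.swap) (simp add: sum_distrib_left)
    finally show ?thesis
      by (simp only: sums) simp
  qed
  define p where "p = (\<Prod>w\<in>z ` I - {z a}. [:-w, 1:])"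
  have fin: "finite (z ` I - {z a})"
    using I by simp
  have p_a: "poly p (z a) \<noteq> 0"
    using fin by (auto simp: p_def poly_prod)
  have p_0: "poly p (z i) = 0" if "i \<in> I" "z i \<noteq> z a" for i
    using fin that by (auto simp: p_def poly_prod)
  have "(\<Sum>i\<in>I. z i * poly p (z i)) = (\<Sum>i\<in>{i\<in>I. z i = z a}. z a * poly p (z a))"
    using I p_0 by (intro sum.mono_neutral_cong_right) auto
  also have "\<dots> = of_nat (card {i\<in>I. z i = z a}) * (z a * poly p (z a))"
    by simp
  finally have "card {i\<in>I. z i = z a} = 0"
    using poly_sum[of p] p_a a by simp
  then show False
    using I \<open>a \<in> I\<close> by (auto simp: card_eq_0_iff)
qed

lemma matrix_vector_mult_axis: "A *v axis j 1 = (\<chi> i. A $ i $ j)" for A :: "'a::semiring_1 ^ 'n ^ 'm"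
  by (simp add: matrix_vector_mult_def axis_def vec_eq_iff if_distrib[where f = "\<lambda>x. _ * x"] cong: if_cong)

lemma matrix_vector_mult_nth: "(A *v x) $ i = (\<Sum>j\<in>UNIV. A $ i $ j * x $ j)"
  by (simp add: matrix_vector_mult_def)

context leibniz
begin

lemma right_mult_apply: "right_mult br y *v x = br x y"
  unfolding right_mult_def by (rule matrix_works[OF linear_left])

lemma right_mult_add: "right_mult br (x + y) = right_mult br x + right_mult br y"
  by (simp add: matrix_eq right_mult_apply add_right matrix_vector_mult_add_rdistrib)

lemma right_mult_scale: "right_mult br (c *s x) $ i $ j = c * right_mult br x $ i $ j"
  by (simp add: right_mult_def matrix_def scale_right)

text \<open>The Leibniz identity says that \<open>x \<mapsto> \<rho>\<^sub>x\<close> reverses brackets.\<close>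
lemma right_mult_bracket:
  "right_mult br (br y z) = right_mult br z ** right_mult br y - right_mult br y ** right_mult br z"
  by (simp add: matrix_eq right_mult_apply leibniz matrix_vector_mult_diff_rdistrib
      flip: matrix_vector_mul_assoc)

lemma simultaneous_triangularization:
  assumes solv: "solvable_alg br UNIV"
  obtains P Q :: "complex ^ 'n ^ 'n" and h :: "'n \<Rightarrow> nat"
  where "P ** Q = mat 1" "Q ** P = mat 1" "bij_betw h UNIV {..<CARD('n)}"
    and "\<And>y. upper_triangular_wrt h (Q ** right_mult br y ** P)"
proof -
  obtain b :: "nat \<Rightarrow> complex ^ 'n"
    where b: "\<And>k. k < CARD('n) \<Longrightarrow> b k \<notin> vec.span (b ` {..<k})"
      and flag: "\<And>k y. k < CARD('n) \<Longrightarrow> \<exists>c. br (b k) y - c *s b k \<in> vec.span (b ` {..<k})"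
    using triangular_basis[OF solv] by blast
  obtain h :: "'n \<Rightarrow> nat" where h: "bij_betw h UNIV {..<CARD('n)}"
    using ex_bij_betw_finite_nat[of "UNIV :: 'n set"] by (auto simp: atLeast0LessThan)
  define P :: "complex ^ 'n ^ 'n" where "P = (\<chi> i j. b (h j) $ i)"
  have P_axis: "P *v axis j 1 = b (h j)" for j
    by (simp add: P_def matrix_vector_mult_axis vec_eq_iff)
  have dim: "k \<le> vec.dim (b ` {..<k})" if "k \<le> CARD('n)" for k
    using that
  proof (induction k)
    case (Suc k)
    then show ?case
      using b[of k] by (simp add: lessThan_Suc vec.dim_insert)
  qed auto
  have "b ` {..<CARD('n)} \<subseteq> range ((*v) P)"
  proof
    fix x assume "x \<in> b ` {..<CARD('n)}"
    then obtain j where "x = b (h j)"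
      using h unfolding bij_betw_def by (metis imageE)
    then show "x \<in> range ((*v) P)"
      using P_axis[of j] by (metis rangeI)
  qed
  moreover have "vec.subspace (range ((*v) P))"
    by (intro vec.subspace_image) simp
  ultimately have span_P: "vec.span (b ` {..<CARD('n)}) \<subseteq> range ((*v) P)"
    by (rule vec.span_minimal)
  have "vec.dim (b ` {..<CARD('n)}) = CARD('n)"
    using dim[of "CARD('n)"] dim_subset_UNIV_cart_gen[of "b ` {..<CARD('n)}"] by simp
  then have "vec.span (b ` {..<CARD('n)}) = UNIV"
    by (intro vec.subspace_dim_equal) (simp_all add: vec_dim_card vec.dim_span card_cart_basis)
  then have "surj ((*v) P)"
    using span_P by blast
  then have "\<exists>Q. P ** Q = mat 1"
    using matrix_right_invertible_surjective by blast
  then obtain Q where PQ: "P ** Q = mat 1" and QP: "Q ** P = mat 1"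
    using matrix_left_right_inverse by blast
  have Q_b: "Q *v b (h j) = axis j 1" for j
    by (simp add: P_axis[symmetric] matrix_vector_mul_assoc QP)
  \<comment> \<open>\<open>Q\<close> computes coordinates with respect to the basis \<open>b\<close>.\<close>
  have Q_span: "(Q *v v) $ i = 0" if "v \<in> vec.span (b ` {..<k})" "k \<le> h i" for v i k
  proof -
    have "v \<in> {v. (Q *v v) $ i = 0}"
      using that(1)
    proof (rule span_subset_induct)
      show "vec.subspace {v. (Q *v v) $ i = 0}"
        by (rule vec.subspaceI) (simp_all add: vec.add vec.scale)
      show "x \<in> {v. (Q *v v) $ i = 0}" if "x \<in> b ` {..<k}" for x
      proof -
        obtain l where l: "l < k" "x = b l"
          using \<open>x \<in> b ` {..<k}\<close> by blast
        have "h i < CARD('n)"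
          using h by (auto simp: bij_betw_def)
        then have "l \<in> {..<CARD('n)}"
          using l \<open>k \<le> h i\<close> by simp
        then obtain j where "l = h j"
          using h unfolding bij_betw_def by (metis imageE)
        then show ?thesis
          using l \<open>k \<le> h i\<close> by (auto simp: Q_b axis_def)
      qed
    qed
    then show ?thesis
      by simp
  qed
  have "upper_triangular_wrt h (Q ** right_mult br y ** P)" for y
    unfolding upper_triangular_wrt_def
  proof (intro allI impI)
    fix i j assume less: "h j < h i"
    have "h j < CARD('n)"
      using h by (auto simp: bij_betw_def)
    then obtain c where c: "br (b (h j)) y - c *s b (h j) \<in> vec.span (b ` {..<h j})"
      using flag by blast
    have "(Q ** right_mult br y ** P) $ i $ j = ((Q ** right_mult br y ** P) *v axis j 1) $ i"
      by (simp add: matrix_vector_mult_axis)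
    also have "\<dots> = (Q *v br (b (h j)) y) $ i"
      by (simp add: P_axis right_mult_apply flip: matrix_vector_mul_assoc)
    also have "\<dots> = (Q *v (br (b (h j)) y - c *s b (h j))) $ i + c * (Q *v b (h j)) $ i"
      by (simp add: vec.diff vec.scale)
    also have "\<dots> = 0"
      using Q_span[OF c, of i] less by (auto simp: Q_b axis_def)
    finally show "(Q ** right_mult br y ** P) $ i $ j = 0" .
  qed
  then show thesis
    using that PQ QP h by blast
qed

text \<open>In triangular form the trace of \<open>\<rho>\<^sub>y\<^sup>k \<rho>\<^sub>x\<close> is the sum of \<open>w\<^sub>i(y)\<^sup>k w\<^sub>i(x)\<close> over the diagonal positions \<open>i\<close>,
  where the weight \<open>w\<^sub>i(x)\<close> is the diagonal entry of \<open>\<rho>\<^sub>x\<close>. Taking \<open>y = x\<close> gives all power sums of the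
  weights of \<open>x\<close>.\<close>
lemma trace_radical_eq_weights_zero:
  fixes P Q :: "complex ^ 'n ^ 'n"
  assumes PQ: "P ** Q = mat 1" and h: "inj h"
    and upper: "\<And>y. upper_triangular_wrt h (Q ** right_mult br y ** P)"
  shows "trace_radical br = {x. \<forall>i. (Q ** right_mult br x ** P) $ i $ i = 0}"
proof -
  let ?w = "\<lambda>x i. (Q ** right_mult br x ** P) $ i $ i"
  have form: "trace_form br y k x = (\<Sum>i\<in>UNIV. ?w y i ^ k * ?w x i)" for y k x
  proof -
    have "trace_form br y k x = trace (Q ** (((**) (right_mult br y) ^^ k) (right_mult br x)) ** P)"
      unfolding trace_form_def by (rule trace_conjugate[OF PQ, symmetric])
    also have "\<dots> = trace (((**) (Q ** right_mult br y ** P) ^^ k) (Q ** right_mult br x ** P))"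
      by (simp only: conjugate_power_mult[OF PQ])
    also have "\<dots> = (\<Sum>i\<in>UNIV. ?w y i ^ k * ?w x i)"
      unfolding trace_def
      by (intro sum.cong refl upper_triangular_wrt_power_mult[OF h upper upper, THEN conjunct2])
    finally show ?thesis .
  qed
  show ?thesis
  proof (intro equalityI subsetI CollectI allI)
    fix x i assume "x \<in> trace_radical br"
    then have "(\<Sum>i\<in>UNIV. ?w x i ^ Suc k) = 0" for k
      using form[of x k x] by (simp add: trace_radical_def mult.commute)
    then show "?w x i = 0"
      by (intro power_sums_zero_imp_zero[of UNIV "?w x" i]) auto
  next
    fix x assume "x \<in> {x. \<forall>i. ?w x i = 0}"
    then show "x \<in> trace_radical br"
      by (simp add: trace_radical_def form)
  qed
qed

lemma right_mult_power_in_lower_central: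
  assumes M: "leibniz_ideal br M" and x: "x \<in> M"
  shows "(((**) (right_mult br x) ^^ k) (right_mult br x)) *v u \<in> lower_central br M k"
proof (induction k)
  case 0
  then show ?case
    using M x by (simp add: right_mult_apply leibniz_ideal_def)
next
  case (Suc k)
  then show ?case
    using x by (auto simp: right_mult_apply simp flip: matrix_vector_mul_assoc intro: bracket_in_span)
qed

text \<open>Diagonal entries of commutators of triangular matrices vanish, so the trace radical contains all
  brackets and is an ideal. It is nilpotent because its elements act strictly triangularly on the flag.
  Finally an element of a nilpotent ideal has a nilpotent right multiplication, whose weights are zero.\<close>
theorem
  assumes solv: "solvable_alg br UNIV"
  shows bracket_in_trace_radical: "br x y \<in> trace_radical br"
    and is_nilradical_trace_radical: "is_nilradical br (trace_radical br)"
proof -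
  obtain P Q :: "complex ^ 'n ^ 'n" and h :: "'n \<Rightarrow> nat"
    where PQ: "P ** Q = mat 1" "Q ** P = mat 1" and bij: "bij_betw h UNIV {..<CARD('n)}"
      and upper: "\<And>y. upper_triangular_wrt h (Q ** right_mult br y ** P)"
    using simultaneous_triangularization[OF solv] by blast
  define T where "T x = Q ** right_mult br x ** P" for x
  have inj: "inj h"
    using bij by (simp add: bij_betw_def)
  note upper = upper[folded T_def]
  have K: "trace_radical br = {x. \<forall>i. T x $ i $ i = 0}"
    using trace_radical_eq_weights_zero[OF PQ(1) inj] upper by (simp add: T_def)
  have T_add: "T (x + y) = T x + T y" for x y
    by (simp add: T_def right_mult_add matrix_eq matrix_vector_mult_add_rdistrib vec.add
        flip: matrix_vector_mul_assoc)
  have T_scale: "T (c *s x) $ i $ i = c * T x $ i $ i" for c x i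
    by (simp add: T_def matrix_matrix_mult_def right_mult_scale sum_distrib_left sum_distrib_right mult_ac)
  have T_zero: "T 0 $ i $ i = 0" for i
    using T_scale[of 0 0 i] by simp
  have T_mult: "T x ** T y = Q ** (right_mult br x ** right_mult br y) ** P" for x y
  proof -
    have "T x ** T y = Q ** right_mult br x ** (P ** Q) ** right_mult br y ** P"
      by (simp only: T_def matrix_mul_assoc)
    then show ?thesis
      using PQ by (simp add: matrix_mul_assoc)
  qed
  have T_bracket: "T (br x y) = T y ** T x - T x ** T y" for x y
    by (simp add: T_mult)
      (simp add: T_def right_mult_bracket matrix_eq matrix_vector_mult_diff_rdistrib vec.diff
        flip: matrix_vector_mul_assoc)
  have bracket_in: "br x y \<in> trace_radical br" for x y
    by (simp add: K T_bracket upper_triangular_wrt_mult(2)[OF inj upper upper] mult.commute)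
  then show "br x y \<in> trace_radical br" .
  have ideal: "leibniz_ideal br (trace_radical br)"
    unfolding leibniz_ideal_def
  proof (intro conjI ballI allI)
    show "vec.subspace (trace_radical br)"
      by (rule vec.subspaceI) (auto simp: K T_add T_scale T_zero)
  qed (rule bracket_in)+
  \<comment> \<open>Each bracket with the trace radical moves down the flag by at least one step.\<close>
  have "lower_central br (trace_radical br) k \<subseteq> {v. \<forall>i. CARD('n) - k \<le> h i \<longrightarrow> (Q *v v) $ i = 0}" for k
  proof (induction k)
    case 0
    have "\<not> CARD('n) \<le> h i" for i
      using bij by (auto simp: bij_betw_def not_le)
    then show ?case
      by auto
  next
    case (Suc k)
    show ?case
      unfolding lower_central.simps(2)
    proof (rule bracket_span_subset)
      show "vec.subspace {v. \<forall>i. CARD('n) - Suc k \<le> h i \<longrightarrow> (Q *v v) $ i = 0}"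
        by (rule vec.subspaceI) (simp_all add: vec.add vec.scale)
      fix v x assume v: "v \<in> lower_central br (trace_radical br) k" and x: "x \<in> trace_radical br"
      have "T x *v (Q *v v) = Q *v (right_mult br x *v ((P ** Q) *v v))"
        by (simp only: T_def matrix_vector_mul_assoc matrix_mul_assoc)
      then have Qbr: "Q *v br v x = T x *v (Q *v v)"
        by (simp add: PQ right_mult_apply)
      have "T x $ i $ j * (Q *v v) $ j = 0" if "CARD('n) - Suc k \<le> h i" for i j
      proof (cases "h i < h j")
        case True
        then have "(Q *v v) $ j = 0"
          using Suc.IH v that by auto
        then show ?thesis
          by simp
      next
        case False
        then have "j = i \<or> h j < h i"
          using injD[OF inj, of i j] by (metis linorder_neqE_nat)
        then have "T x $ i $ j = 0"
          using x upper[of x] by (auto simp: K upper_triangular_wrt_def)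
        then show ?thesis
          by simp
      qed
      then show "br v x \<in> {v. \<forall>i. CARD('n) - Suc k \<le> h i \<longrightarrow> (Q *v v) $ i = 0}"
        unfolding mem_Collect_eq Qbr matrix_vector_mult_nth[of "T x"]
        by (intro allI impI sum.neutral ballI) blast
    qed
  qed
  from this[of "CARD('n)"] have "lower_central br (trace_radical br) CARD('n) \<subseteq> {v. Q *v v = 0}"
    by (auto simp: vec_eq_iff)
  moreover have "v = 0" if "Q *v v = 0" for v
    using that PQ by (metis matrix_vector_mul_assoc matrix_vector_mul_lid matrix_vector_mult_0_right)
  moreover have "0 \<in> lower_central br (trace_radical br) CARD('n)"
    using ideal by (cases "CARD('n)") (auto simp: bracket_span_def vec.span_zero leibniz_ideal_def vec.subspace_0)
  ultimately have "lower_central br (trace_radical br) CARD('n) = {0}"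
    by blast
  then have nilp: "nilpotent_alg br (trace_radical br)"
    unfolding nilpotent_alg_def by blast
  have "M \<subseteq> trace_radical br" if M: "leibniz_ideal br M" "nilpotent_alg br M" for M
  proof
    fix x assume x: "x \<in> M"
    obtain k where k: "lower_central br M k = {0}"
      using M(2) unfolding nilpotent_alg_def by blast
    have "((**) (right_mult br x) ^^ k) (right_mult br x) = 0"
      using right_mult_power_in_lower_central[OF M(1) x, of k] k by (simp add: matrix_eq)
    then have "((**) (T x) ^^ k) (T x) = 0"
      using conjugate_power_mult[OF PQ(1), where A = "right_mult br x" and B = "right_mult br x" and k = k]
      by (simp add: T_def)
    then have "T x $ i $ i ^ k * T x $ i $ i = 0" for i
      using upper_triangular_wrt_power_mult[OF inj upper upper, of k x x i] by simp
    then show "x \<in> trace_radical br"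
      by (auto simp: K)
  qed
  then show "is_nilradical br (trace_radical br)"
    using ideal nilp by (auto simp: is_nilradical_def)
qed

lemma nilradical_unique: "is_nilradical br M \<Longrightarrow> is_nilradical br N \<Longrightarrow> M = N"
  by (meson is_nilradical_def subset_antisym)

end

section \<open>Polynomial dependence on structure constants\<close>

lemma polynomial_fun_sum:
  "finite I \<Longrightarrow> (\<And>i. i \<in> I \<Longrightarrow> polynomial_fun (f i)) \<Longrightarrow> polynomial_fun (\<lambda>v. \<Sum>i\<in>I. f i v)"
  by (induction I rule: finite_induct) (auto intro: polynomial_fun.intros)

lemma polynomial_fun_prod:
  "finite I \<Longrightarrow> (\<And>i. i \<in> I \<Longrightarrow> polynomial_fun (f i)) \<Longrightarrow> polynomial_fun (\<lambda>v. \<Prod>i\<in>I. f i v)"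
  by (induction I rule: finite_induct) (auto intro: polynomial_fun.intros)

lemma polynomial_fun_power: "polynomial_fun f \<Longrightarrow> polynomial_fun (\<lambda>v. f v ^ k)"
  by (induction k) (auto intro: polynomial_fun.intros)

lemma polynomial_fun_matrix_mult:
  fixes A :: "('i \<Rightarrow> complex) \<Rightarrow> complex ^ 'm ^ 'l" and B :: "('i \<Rightarrow> complex) \<Rightarrow> complex ^ 'k ^ 'm"
  assumes "\<And>i j. polynomial_fun (\<lambda>v. A v $ i $ j)" "\<And>i j. polynomial_fun (\<lambda>v. B v $ i $ j)"
  shows "polynomial_fun (\<lambda>v. (A v ** B v) $ i $ j)"
  unfolding matrix_matrix_mult_def vec_lambda_beta
  by (intro polynomial_fun_sum polynomial_fun.mult assms) auto

lemma polynomial_fun_det: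
  fixes A :: "('i \<Rightarrow> complex) \<Rightarrow> complex ^ 'n ^ 'n"
  assumes "\<And>i j. polynomial_fun (\<lambda>v. A v $ i $ j)"
  shows "polynomial_fun (\<lambda>v. det (A v))"
  unfolding det_def
  by (intro polynomial_fun_sum polynomial_fun.mult polynomial_fun.const polynomial_fun_prod assms)
    (auto simp: finite_permutations)

text \<open>A polynomial in fractions with common denominator \<open>d\<close> becomes a polynomial after multiplication by a
  power of \<open>d\<close>.\<close>
lemma polynomial_fun_clear_denominator:
  assumes "polynomial_fun p" and a: "\<And>i. polynomial_fun (a i)" and d: "polynomial_fun d"
  shows "\<exists>q m. polynomial_fun q \<and> (\<forall>v. d v \<noteq> 0 \<longrightarrow> q v = d v ^ m * p (\<lambda>i. a i v / d v))"
  using assms(1)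
proof induction
  case (const c)
  show ?case
    by (intro exI[of _ "\<lambda>_. c"] exI[of _ 0]) (auto intro: polynomial_fun.const)
next
  case (var i)
  show ?case
    by (intro exI[of _ "a i"] exI[of _ 1]) (auto intro: a)
next
  case (add p1 p2)
  then obtain q1 m1 q2 m2 where q: "polynomial_fun q1" "polynomial_fun q2"
    "\<forall>v. d v \<noteq> 0 \<longrightarrow> q1 v = d v ^ m1 * p1 (\<lambda>i. a i v / d v)"
    "\<forall>v. d v \<noteq> 0 \<longrightarrow> q2 v = d v ^ m2 * p2 (\<lambda>i. a i v / d v)"
    by blast
  then show ?case
    by (intro exI[of _ "\<lambda>v. d v ^ m2 * q1 v + d v ^ m1 * q2 v"] exI[of _ "m1 + m2"])
      (auto intro!: polynomial_fun.add polynomial_fun.mult polynomial_fun_power d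
        simp: power_add algebra_simps)
next
  case (mult p1 p2)
  then obtain q1 m1 q2 m2 where q: "polynomial_fun q1" "polynomial_fun q2"
    "\<forall>v. d v \<noteq> 0 \<longrightarrow> q1 v = d v ^ m1 * p1 (\<lambda>i. a i v / d v)"
    "\<forall>v. d v \<noteq> 0 \<longrightarrow> q2 v = d v ^ m2 * p2 (\<lambda>i. a i v / d v)"
    by blast
  then show ?case
    by (intro exI[of _ "\<lambda>v. q1 v * q2 v"] exI[of _ "m1 + m2"])
      (auto intro!: polynomial_fun.mult simp: power_add)
qed

text \<open>This inverts \<open>struct_const\<close> on bilinear brackets and thus lets any expression in a bracket be read as
  a function of structure constants.\<close>
definition bracket_of :: "('n \<times> 'n \<times> 'n \<Rightarrow> complex) \<Rightarrow> ('n::finite) bracket" where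
  "bracket_of v x y = (\<chi> k. \<Sum>a\<in>UNIV. \<Sum>b\<in>UNIV. x $ a * y $ b * v (a, b, k))"

lemma (in bilinear_bracket) bracket_expand:
  "br x y = (\<Sum>a\<in>UNIV. \<Sum>b\<in>UNIV. (x $ a * y $ b) *s br (axis a 1) (axis b 1))"
proof -
  have "br x y = br (\<Sum>a\<in>UNIV. x $ a *s axis a 1) (\<Sum>b\<in>UNIV. y $ b *s axis b 1)"
    by (simp only: basis_expansion)
  also have "\<dots> = (\<Sum>a\<in>UNIV. \<Sum>b\<in>UNIV. (x $ a * y $ b) *s br (axis a 1) (axis b 1))"
    unfolding sum_left sum_right scale_left scale_right vec.scale_sum_right vec.scale_scale
    by (subst sum.swap) (simp add: mult.commute)
  finally show ?thesis .
qed

lemma (in bilinear_bracket) bracket_of_struct_const: "bracket_of (struct_const br) = br"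
proof (intro ext)
  fix x y
  show "bracket_of (struct_const br) x y = br x y"
    unfolding bracket_expand[of x y] by (simp add: vec_eq_iff bracket_of_def struct_const_def)
qed

lemma polynomial_fun_bracket_of:
  assumes "\<And>i. polynomial_fun (\<lambda>v. F v $ i)" "\<And>i. polynomial_fun (\<lambda>v. G v $ i)"
  shows "polynomial_fun (\<lambda>v. bracket_of v (F v) (G v) $ k)"
  unfolding bracket_of_def vec_lambda_beta
  by (intro polynomial_fun_sum polynomial_fun.mult polynomial_fun.var assms) auto

lemma polynomial_fun_trace_form: "polynomial_fun (\<lambda>v. trace_form (bracket_of v) y k x)"
proof -
  have right_mult: "polynomial_fun (\<lambda>v. right_mult (bracket_of v) z $ i $ j)" for z :: "complex ^ 'a" and i j
    unfolding right_mult_def matrix_def vec_lambda_beta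
    by (intro polynomial_fun_bracket_of polynomial_fun.const)
  have "polynomial_fun (\<lambda>v. (((**) (right_mult (bracket_of v) y) ^^ k) (right_mult (bracket_of v) x)) $ i $ j)" for i j
  proof (induction k arbitrary: i j)
    case (Suc k)
    then show ?case
      by (auto intro!: polynomial_fun_matrix_mult right_mult)
  qed (simp add: right_mult)
  then show ?thesis
    unfolding trace_form_def trace_def by (intro polynomial_fun_sum) auto
qed

lemma bracket_span_eq_span_axis:
  assumes "br \<in> bilinear_brackets"
  shows "bracket_span br UNIV UNIV = vec.span (range (\<lambda>(a, b). br (axis a 1) (axis b 1)))"
proof
  interpret bilinear_bracket br
    using assms by unfold_locales
  show "bracket_span br UNIV UNIV \<subseteq> vec.span (range (\<lambda>(a, b). br (axis a 1) (axis b 1)))"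
  proof (rule bracket_span_subset)
    fix x y
    show "br x y \<in> vec.span (range (\<lambda>(a, b). br (axis a 1) (axis b 1)))"
      unfolding bracket_expand[of x y]
      by (intro vec.span_sum vec.span_scale vec.span_base) auto
  qed simp
  show "vec.span (range (\<lambda>(a, b). br (axis a 1) (axis b 1))) \<subseteq> bracket_span br UNIV UNIV"
    by (intro vec.span_minimal subspace_bracket_span) (auto intro: bracket_in_span)
qed

lemma (in bilinear_bracket) trace_form_expand:
  "trace_form br y k x = (\<Sum>l\<in>UNIV. trace_form br y k (axis l 1) * x $ l)"
proof -
  let ?A = "(**) (right_mult br y) ^^ k"
  have "br u x = (\<Sum>l\<in>UNIV. x $ l *s br u (axis l 1))" for u
  proof -
    have "br u x = br u (\<Sum>l\<in>UNIV. x $ l *s axis l 1)"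
      by (simp only: basis_expansion)
    then show ?thesis
      by (simp only: sum_right scale_right)
  qed
  then have right_mult: "right_mult br x $ i $ j = (\<Sum>l\<in>UNIV. right_mult br (axis l 1) $ i $ j * x $ l)" for i j
    by (simp add: right_mult_def matrix_def mult.commute)
  have entries: "?A (right_mult br x) $ i $ j = (\<Sum>l\<in>UNIV. ?A (right_mult br (axis l 1)) $ i $ j * x $ l)" for i j
  proof (induction k arbitrary: i j)
    case 0
    then show ?case
      using right_mult by simp
  next
    case (Suc k)
    then show ?case
      by (simp add: matrix_matrix_mult_def sum_distrib_left sum_distrib_right mult_ac)
        (rule sum.swap)
  qed
  show ?thesis
    unfolding trace_form_def trace_def entries sum_distrib_right by (rule sum.swap)
qed

text \<open>A maximal independent subfamily is completed by constant vectors \<open>c i\<close>. If \<open>w\<close> depends polynomially on a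
  parameter, the determinant is then a polynomial whose nonvanishing keeps the rows in \<open>S\<close> independent;
  this is how both semicontinuity arguments below work.\<close>
lemma complete_to_invertible:
  fixes w :: "'j \<Rightarrow> 'a::field ^ 'n"
  obtains S idx c where "det (\<chi> i. if i \<in> S then w (idx i) else c i) \<noteq> 0"
    and "vec.span ((\<lambda>i. w (idx i)) ` S) = vec.span (range w)"
    and "card S = vec.dim (range w)"
proof -
  obtain B where B: "B \<subseteq> range w" "vec.independent B" "range w \<subseteq> vec.span B" "card B = vec.dim (range w)"
    by (rule vec.basis_exists[of "range w"])
  obtain B' where B': "B \<subseteq> B'" "B' \<subseteq> UNIV" "vec.independent B'" "UNIV \<subseteq> vec.span B'"
    by (rule vec.maximal_independent_subset_extend[OF subset_UNIV B(2)])
  have "card B' = CARD('n)"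
    using vec.basis_card_eq_dim[OF B'(2,4,3)] by (simp add: vec_dim_card card_cart_basis)
  then obtain e :: "'n \<Rightarrow> 'a ^ 'n" where e: "bij_betw e UNIV B'"
    using finite_same_card_bij[of "UNIV :: 'n set" B'] vec.finiteI_independent[OF B'(3)] by auto
  define S where "S = {i. e i \<in> B}"
  define idx where "idx i = (SOME j. w j = e i)" for i
  have idx: "w (idx i) = e i" if "i \<in> S" for i
  proof -
    have "e i \<in> range w"
      using that B(1) by (auto simp: S_def)
    then have "\<exists>j. w j = e i"
      by (metis imageE)
    then show ?thesis
      unfolding idx_def by (rule someI_ex)
  qed
  have A: "(\<chi> i. if i \<in> S then w (idx i) else e i) = (\<chi> i. e i)"
    by (simp add: vec_eq_iff idx)
  have "rows (\<chi> i. e i) = B'"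
    using e by (auto simp: rows_def row_def bij_betw_def)
  then have "\<exists>C. C ** (\<chi> i. e i) = mat 1"
    using B'(4) unfolding matrix_left_invertible_span_rows_gen by auto
  then have "det (\<chi> i. if i \<in> S then w (idx i) else e i) \<noteq> 0"
    unfolding A by (simp add: invertible_left_inverse flip: invertible_det_nz)
  moreover have img: "e ` S = B"
    using e B'(1) by (auto simp: S_def bij_betw_def)
  then have "(\<lambda>i. w (idx i)) ` S = B"
    using idx by (simp cong: image_cong)
  then have "vec.span ((\<lambda>i. w (idx i)) ` S) = vec.span (range w)"
    using B(1,3) by (simp add: vec.span_eq) (meson order.trans vec.span_superset)
  moreover have "inj_on e S"
    using e by (auto simp: bij_betw_def intro: inj_on_subset)
  then have "card S = vec.dim (range w)"
    using img B(4) card_image by fastforce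
  ultimately show thesis
    using that by blast
qed

lemma dim_common_kernel_rows:
  fixes A :: "'a::field ^ 'n ^ 'n"
  assumes "det A \<noteq> 0"
  shows "vec.dim {x. \<forall>i\<in>S. (A *v x) $ i = 0} + card S = CARD('n)"
proof -
  obtain B where AB: "A ** B = mat 1" "B ** A = mat 1"
    using assms by (metis invertible_def invertible_det_nz)
  let ?K = "{x. \<forall>i\<in>S. (A *v x) $ i = 0}"
  have "inj ((*v) A)"
    using AB by (metis injI matrix_vector_mul_assoc matrix_vector_mul_lid)
  then have "vec.dim ((*v) A ` ?K) = vec.dim ?K"
    by (intro vec.dim_image_eq) (auto intro: inj_on_subset)
  moreover have "(*v) A ` ?K = {y :: 'a ^ 'n. \<forall>i. i \<notin> - S \<longrightarrow> y $ i = 0}"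
  proof
    show "{y :: 'a ^ 'n. \<forall>i. i \<notin> - S \<longrightarrow> y $ i = 0} \<subseteq> (*v) A ` ?K"
    proof
      fix y assume y: "y \<in> {y :: 'a ^ 'n. \<forall>i. i \<notin> - S \<longrightarrow> y $ i = 0}"
      have "y = A *v (B *v y)"
        by (simp add: matrix_vector_mul_assoc AB)
      moreover from this have "B *v y \<in> ?K"
        using y by auto
      ultimately show "y \<in> (*v) A ` ?K"
        by blast
    qed
  qed auto
  moreover have "vec.dim {y :: 'a ^ 'n. \<forall>i. i \<notin> - S \<longrightarrow> y $ i = 0} = card (- S)"
    by (rule dim_substandard_cart)
  moreover have "card (- S) + card S = CARD('n)"
    using card_Un_disjoint[of "- S" S] by (simp add: Un_commute)
  ultimately show ?thesis
    by simp
qed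

text \<open>The trace radical is the common kernel of linear forms with polynomial coefficients, and forms that are
  independent at \<open>R\<close> remain independent where a determinant does not vanish.\<close>
lemma dim_trace_radical_semicontinuous:
  fixes R :: "('n::finite) bracket"
  assumes R: "R \<in> bilinear_brackets"
  obtains q where "polynomial_fun q" "q (struct_const R) \<noteq> 0"
    and "\<And>br. br \<in> bilinear_brackets \<Longrightarrow> q (struct_const br) \<noteq> 0 \<Longrightarrow>
           vec.dim (trace_radical br) \<le> vec.dim (trace_radical R)"
proof -
  define w where "w br = (\<lambda>(y, k). \<chi> l. trace_form br y k (axis l 1))" for br :: "'n bracket"
  have radical: "trace_radical br = {x. \<forall>j. (\<Sum>l\<in>UNIV. w br j $ l * x $ l) = 0}"
    if "br \<in> bilinear_brackets" for br
  proof -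
    interpret bilinear_bracket br
      using that by unfold_locales
    have "trace_form br y k x = (\<Sum>l\<in>UNIV. w br (y, k) $ l * x $ l)" for y k x
      unfolding w_def prod.case vec_lambda_beta by (rule trace_form_expand)
    then show ?thesis
      by (simp add: trace_radical_def split_paired_all)
  qed
  obtain S idx c where det: "det (\<chi> i. if i \<in> S then w R (idx i) else c i) \<noteq> 0"
    and span: "vec.span ((\<lambda>i. w R (idx i)) ` S) = vec.span (range (w R))"
    by (rule complete_to_invertible[of "w R"])
  define A where "A br = (\<chi> i. if i \<in> S then w br (idx i) else c i)" for br
  have A_nth: "(A br *v x) $ i = (\<Sum>l\<in>UNIV. w br (idx i) $ l * x $ l)" if "i \<in> S" for br x i
    using that by (simp add: A_def matrix_vector_mult_nth)
  have "x \<in> trace_radical R" if x: "\<forall>i\<in>S. (A R *v x) $ i = 0" for x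
  proof -
    have "u \<in> {u. (\<Sum>l\<in>UNIV. u $ l * x $ l) = 0}" if "u \<in> vec.span ((\<lambda>i. w R (idx i)) ` S)" for u
      using that
    proof (rule span_subset_induct)
      show "vec.subspace {u. (\<Sum>l\<in>UNIV. u $ l * x $ l) = 0}"
        by (rule vec.subspaceI) (simp_all add: distrib_right sum.distrib mult.assoc flip: sum_distrib_left)
    qed (use x A_nth in auto)
    moreover have "w R j \<in> vec.span ((\<lambda>i. w R (idx i)) ` S)" for j
      unfolding span by (intro vec.span_base) auto
    ultimately show ?thesis
      unfolding radical[OF R] by blast
  qed
  then have "vec.dim {x. \<forall>i\<in>S. (A R *v x) $ i = 0} \<le> vec.dim (trace_radical R)"
    by (intro vec.dim_subset) auto
  then have dim_R: "CARD('n) \<le> vec.dim (trace_radical R) + card S"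
    using dim_common_kernel_rows[of "A R" S] det by (simp add: A_def)
  show thesis
  proof (rule that)
    show "polynomial_fun (\<lambda>v. det (A (bracket_of v)))"
    proof (rule polynomial_fun_det)
      fix i j
      show "polynomial_fun (\<lambda>v. A (bracket_of v) $ i $ j)"
        by (cases "i \<in> S") (simp_all add: A_def w_def split_def polynomial_fun_trace_form polynomial_fun.const)
    qed
    have sc: "bracket_of (struct_const br) = br" if "br \<in> bilinear_brackets" for br :: "'n bracket"
      using that by (intro bilinear_bracket.bracket_of_struct_const bilinear_bracket.intro)
    show "det (A (bracket_of (struct_const R))) \<noteq> 0"
      using det by (simp add: sc[OF R] A_def)
    fix br :: "'n bracket" assume br: "br \<in> bilinear_brackets"
      and nz: "det (A (bracket_of (struct_const br))) \<noteq> 0"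
    have "vec.dim (trace_radical br) \<le> vec.dim {x. \<forall>i\<in>S. (A br *v x) $ i = 0}"
      unfolding radical[OF br]
      by (intro vec.dim_subset subsetI CollectI ballI) (simp only: A_nth mem_Collect_eq)
    then show "vec.dim (trace_radical br) \<le> vec.dim (trace_radical R)"
      using dim_common_kernel_rows[of "A br" S] nz dim_R by (simp add: sc[OF br])
  qed
qed

section \<open>Embeddings of algebras and the action of the general linear group\<close>

lemma bracket_of_bilinear: "bracket_of v \<in> bilinear_brackets"
  unfolding bilinear_brackets_def Vector_Spaces.linear_iff bracket_of_def
  by (auto simp: vec_eq_iff sum.distrib sum_distrib_left distrib_left distrib_right mult_ac vec.vector_space_axioms)

lemma struct_const_bracket_of: "struct_const (bracket_of v) = v"
proof
  fix t :: "'a \<times> 'a \<times> 'a"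
  obtain i j k where t: "t = (i, j, k)"
    by (cases t)
  have "(axis i 1 $ a * axis j 1 $ b * v (a, b, k)) = (if b = j then if a = i then v (i, j, k) else 0 else 0)" for a b
    by (auto simp: axis_def)
  then show "struct_const (bracket_of v) t = v t"
    by (simp add: t struct_const_def bracket_of_def)
qed

definition algebra_embedding ::
  "(complex ^ 'm \<Rightarrow> complex ^ 'n) \<Rightarrow> ('m::finite) bracket \<Rightarrow> ('n::finite) bracket \<Rightarrow> bool" where
  "algebra_embedding \<tau> br br' \<longleftrightarrow> Vector_Spaces.linear (*s) (*s) \<tau> \<and> inj \<tau> \<and>
     (\<forall>x y. \<tau> (br x y) = br' (\<tau> x) (\<tau> y))"

lemma algebra_embedding_compose:
  assumes "algebra_embedding \<tau> br br'" "algebra_embedding \<sigma> br' br''"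
  shows "algebra_embedding (\<sigma> \<circ> \<tau>) br br''"
proof -
  interpret \<tau>: Vector_Spaces.linear "(*s)" "(*s)" \<tau>
    using assms by (simp add: algebra_embedding_def)
  interpret \<sigma>: Vector_Spaces.linear "(*s)" "(*s)" \<sigma>
    using assms by (simp add: algebra_embedding_def)
  have "Vector_Spaces.linear (*s) (*s) (\<sigma> \<circ> \<tau>)"
    by (simp add: Vector_Spaces.linear_iff vec.vector_space_axioms
        \<tau>.add \<sigma>.add \<tau>.scale \<sigma>.scale)
  moreover have "inj (\<sigma> \<circ> \<tau>)"
    using assms by (intro inj_compose) (simp_all add: algebra_embedding_def)
  ultimately show ?thesis
    using assms by (simp add: algebra_embedding_def)
qed

lemma embedding_bracket_span:
  assumes "algebra_embedding \<tau> br br'"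
  shows "bracket_span br' (\<tau> ` A) (\<tau> ` B) = \<tau> ` bracket_span br A B"
proof -
  interpret \<tau>: Vector_Spaces.linear "(*s)" "(*s)" \<tau>
    using assms by (simp add: algebra_embedding_def)
  have hom: "\<tau> (br x y) = br' (\<tau> x) (\<tau> y)" for x y
    using assms by (simp add: algebra_embedding_def)
  have "{br' x y | x y. x \<in> \<tau> ` A \<and> y \<in> \<tau> ` B} = \<tau> ` {br x y | x y. x \<in> A \<and> y \<in> B}"
  proof (intro equalityI subsetI)
    fix z assume "z \<in> {br' x y | x y. x \<in> \<tau> ` A \<and> y \<in> \<tau> ` B}"
    then obtain x y where "x \<in> A" "y \<in> B" "z = br' (\<tau> x) (\<tau> y)"
      by blast
    then show "z \<in> \<tau> ` {br x y | x y. x \<in> A \<and> y \<in> B}"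
      unfolding hom[symmetric] by blast
  next
    fix z assume "z \<in> \<tau> ` {br x y | x y. x \<in> A \<and> y \<in> B}"
    then obtain x y where "x \<in> A" "y \<in> B" "z = \<tau> (br x y)"
      by blast
    then show "z \<in> {br' x y | x y. x \<in> \<tau> ` A \<and> y \<in> \<tau> ` B}"
      unfolding hom by blast
  qed
  then show ?thesis
    by (simp add: bracket_span_def \<tau>.span_image)
qed

lemma embedding_lower_central:
  assumes "algebra_embedding \<tau> br br'"
  shows "lower_central br' (\<tau> ` M) k = \<tau> ` lower_central br M k"
  by (induction k) (simp_all add: embedding_bracket_span[OF assms])

lemma embedding_derived_series:
  assumes "algebra_embedding \<tau> br br'"
  shows "derived_series br' (\<tau> ` M) k = \<tau> ` derived_series br M k"
  by (induction k) (simp_all add: embedding_bracket_span[OF assms])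

lemma embedding_image_eq_zero_iff:
  assumes "algebra_embedding \<tau> br br'"
  shows "\<tau> ` S = {0} \<longleftrightarrow> S = {0}"
proof -
  interpret \<tau>: Vector_Spaces.linear "(*s)" "(*s)" \<tau>
    using assms by (simp add: algebra_embedding_def)
  have "\<tau> ` S = \<tau> ` {0} \<longleftrightarrow> S = {0}"
    using assms by (intro inj_image_eq_iff) (simp add: algebra_embedding_def)
  then show ?thesis
    by simp
qed

lemma embedding_nilpotent_iff:
  "algebra_embedding \<tau> br br' \<Longrightarrow> nilpotent_alg br' (\<tau> ` M) \<longleftrightarrow> nilpotent_alg br M"
  by (simp add: nilpotent_alg_def embedding_lower_central embedding_image_eq_zero_iff)

lemma embedding_solvable_iff:
  "algebra_embedding \<tau> br br' \<Longrightarrow> solvable_alg br' (\<tau> ` M) \<longleftrightarrow> solvable_alg br M"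
  by (simp add: solvable_alg_def embedding_derived_series embedding_image_eq_zero_iff)

lemma embedding_into_Leib:
  assumes \<tau>: "algebra_embedding \<tau> br br'" and "br' \<in> Leib" "br \<in> bilinear_brackets"
  shows "br \<in> Leib"
proof -
  interpret \<tau>: Vector_Spaces.linear "(*s)" "(*s)" \<tau>
    using \<tau> by (simp add: algebra_embedding_def)
  have "\<tau> (br x (br y z)) = \<tau> (br (br x y) z - br (br x z) y)" for x y z
    using assms by (simp add: algebra_embedding_def \<tau>.diff Leib_def)
  moreover have "inj \<tau>"
    using \<tau> by (simp add: algebra_embedding_def)
  ultimately have "br x (br y z) = br (br x y) z - br (br x z) y" for x y z
    by (metis injD)
  then show ?thesis
    using assms by (simp add: Leib_def)
qed

lemma nilradical_image:
  assumes \<tau>: "algebra_embedding \<tau> br br'" and "surj \<tau>" and N: "is_nilradical br N"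
  shows "is_nilradical br' (\<tau> ` N)"
proof -
  interpret \<tau>: Vector_Spaces.linear "(*s)" "(*s)" \<tau>
    using \<tau> by (simp add: algebra_embedding_def)
  have hom: "br' (\<tau> x) (\<tau> y) = \<tau> (br x y)" for x y
    using \<tau> by (simp add: algebra_embedding_def)
  have surj: "\<exists>y'. y = \<tau> y'" for y
    using \<open>surj \<tau>\<close> by (rule surjD)
  have ideal_N: "leibniz_ideal br N"
    using N by (simp add: is_nilradical_def)
  show ?thesis
    unfolding is_nilradical_def
  proof (intro conjI allI impI)
    show "leibniz_ideal br' (\<tau> ` N)"
      unfolding leibniz_ideal_def
    proof (intro conjI ballI allI)
      show "vec.subspace (\<tau> ` N)"
        using ideal_N by (intro \<tau>.subspace_image) (simp add: leibniz_ideal_def)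
      fix x y assume "x \<in> \<tau> ` N"
      then obtain x' where x: "x' \<in> N" "x = \<tau> x'"
        by blast
      obtain y' where y: "y = \<tau> y'"
        using surj by blast
      show "br' x y \<in> \<tau> ` N" "br' y x \<in> \<tau> ` N"
        using ideal_N x y by (auto simp: hom leibniz_ideal_def)
    qed
    show "nilpotent_alg br' (\<tau> ` N)"
      using N by (simp add: embedding_nilpotent_iff[OF \<tau>] is_nilradical_def)
    fix M assume M: "leibniz_ideal br' M \<and> nilpotent_alg br' M"
    have img: "\<tau> ` (\<tau> -` M) = M"
      using \<open>surj \<tau>\<close> by (rule surj_image_vimage_eq)
    have "leibniz_ideal br (\<tau> -` M)"
      using M \<tau>.subspace_vimage[of M] by (auto simp: leibniz_ideal_def simp flip: hom)
    moreover have "nilpotent_alg br (\<tau> -` M)"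
      using M embedding_nilpotent_iff[OF \<tau>, of "\<tau> -` M"] unfolding img by simp
    ultimately have "\<tau> -` M \<subseteq> N"
      using N by (simp add: is_nilradical_def)
    then show "M \<subseteq> \<tau> ` N"
      using img by blast
  qed
qed

lemma matrix_inv_mult:
  assumes "invertible g"
  shows "g ** matrix_inv g = mat 1" "matrix_inv g ** g = mat 1"
  using assms someI_ex[of "\<lambda>h. g ** h = mat 1 \<and> h ** g = mat 1"]
  by (auto simp: invertible_def matrix_inv_def)

text \<open>The embedding goes from the transformed bracket back to \<open>br\<close>: in this direction the Leibniz identity
  and the solvability of \<open>br\<close> pass to \<open>gl_act g br\<close>, by \<open>embedding_into_Leib\<close> and its companions.\<close>
lemma gl_act_embedding:
  assumes g: "invertible g"
  shows "algebra_embedding ((*v) (matrix_inv g)) (gl_act g br) br" and "surj ((*v) (matrix_inv g))"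
proof -
  have left: "matrix_inv g *v (g *v x) = x" and right: "g *v (matrix_inv g *v x) = x" for x
    using matrix_inv_mult[OF g] by (simp_all add: matrix_vector_mul_assoc)
  have "inj ((*v) (matrix_inv g))"
    by (rule inj_on_inverseI[of _ "(*v) g"]) (simp add: right)
  then show "algebra_embedding ((*v) (matrix_inv g)) (gl_act g br) br"
    by (simp add: algebra_embedding_def gl_act_def left)
  show "surj ((*v) (matrix_inv g))"
    by (rule surjI[of _ "(*v) g"]) (rule left)
qed

lemma gl_act_bilinear:
  assumes "br \<in> bilinear_brackets"
  shows "gl_act g br \<in> bilinear_brackets"
proof -
  interpret bilinear_bracket br
    using assms by unfold_locales
  show ?thesis
    unfolding bilinear_brackets_def Vector_Spaces.linear_iff gl_act_def
    by (simp add: vec.add vec.scale add_left add_right scale_left scale_right vec.vector_space_axioms)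
qed

text \<open>The change of basis is \<open>\<tau>\<inverse> f\<close>, restricted to the common range.\<close>
lemma embeddings_same_range_imp_orbit:
  assumes f: "algebra_embedding f \<nu> br" and \<tau>: "algebra_embedding \<tau> \<nu>' br"
    and range: "range \<tau> = range f"
  shows "\<nu>' \<in> gl_orbit \<nu>"
proof -
  interpret f: Vector_Spaces.linear "(*s)" "(*s)" f
    using f by (simp add: algebra_embedding_def)
  interpret \<tau>: Vector_Spaces.linear "(*s)" "(*s)" \<tau>
    using \<tau> by (simp add: algebra_embedding_def)
  have inj: "f x = f y \<longleftrightarrow> x = y" "\<tau> z = \<tau> z' \<longleftrightarrow> z = z'" for x y z z'
    using f \<tau> by (auto simp: algebra_embedding_def inj_eq)
  define \<theta> where "\<theta> x = inv f (\<tau> x)" for x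
  define \<eta> where "\<eta> x = inv \<tau> (f x)" for x
  have f_\<theta>: "f (\<theta> x) = \<tau> x" for x
    unfolding \<theta>_def using range by (intro f_inv_into_f) auto
  have \<tau>_\<eta>: "\<tau> (\<eta> x) = f x" for x
    unfolding \<eta>_def using range by (intro f_inv_into_f) auto
  have lin: "Vector_Spaces.linear (*s) (*s) \<theta>"
    unfolding Vector_Spaces.linear_iff
    by (auto simp: vec.vector_space_axioms f_\<theta> f.add \<tau>.add f.scale \<tau>.scale simp flip: inj(1))
  have lin': "Vector_Spaces.linear (*s) (*s) \<eta>"
    unfolding Vector_Spaces.linear_iff
    by (auto simp: vec.vector_space_axioms \<tau>_\<eta> f.add \<tau>.add f.scale \<tau>.scale simp flip: inj(2))
  have \<eta>\<theta>: "\<eta> (\<theta> x) = x" for x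
    by (simp add: \<tau>_\<eta> f_\<theta> flip: inj(2))
  have \<theta>\<eta>: "\<theta> (\<eta> x) = x" for x
    by (simp add: \<tau>_\<eta> f_\<theta> flip: inj(1))
  have mats: "matrix \<eta> ** matrix \<theta> = mat 1" "matrix \<theta> ** matrix \<eta> = mat 1"
    by (simp_all add: matrix_eq matrix_works lin lin' \<eta>\<theta> \<theta>\<eta> flip: matrix_vector_mul_assoc)
  then have inv: "invertible (matrix \<eta>)"
    by (auto simp: invertible_def)
  then have "matrix_inv (matrix \<eta>) = matrix \<theta>"
    using mats matrix_inv_mult[OF inv] by (metis matrix_mul_assoc matrix_mul_lid matrix_mul_rid)
  moreover have "\<eta> (\<nu> (\<theta> x) (\<theta> y)) = \<nu>' x y" for x y
    using f \<tau> by (simp add: \<tau>_\<eta> algebra_embedding_def f_\<theta> flip: inj(2))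
  ultimately have "gl_act (matrix \<eta>) \<nu> = \<nu>'"
    by (simp add: gl_act_def fun_eq_iff matrix_works lin lin')
  then show ?thesis
    using inv unfolding gl_orbit_def by blast
qed

lemma alg_iso_ranges:
  assumes \<alpha>: "algebra_embedding \<alpha> \<nu> br1" and \<beta>: "algebra_embedding \<beta> \<nu> br2"
  shows "alg_iso br1 (range \<alpha>) br2 (range \<beta>)"
proof -
  interpret \<alpha>: Vector_Spaces.linear "(*s)" "(*s)" \<alpha>
    using \<alpha> by (simp add: algebra_embedding_def)
  interpret \<beta>: Vector_Spaces.linear "(*s)" "(*s)" \<beta>
    using \<beta> by (simp add: algebra_embedding_def)
  have inv: "inv \<alpha> (\<alpha> x) = x" for x
    using \<alpha> by (simp add: algebra_embedding_def inv_f_f)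
  have bij: "bij_betw \<alpha> UNIV (range \<alpha>)" "bij_betw \<beta> UNIV (range \<beta>)"
    using \<alpha> \<beta> by (simp_all add: algebra_embedding_def bij_betw_def)
  have hom: "br1 (\<alpha> x) (\<alpha> y) = \<alpha> (\<nu> x y)" "br2 (\<beta> x) (\<beta> y) = \<beta> (\<nu> x y)" for x y
    using \<alpha> \<beta> by (simp_all add: algebra_embedding_def)
  have "bij_betw (\<beta> \<circ> inv \<alpha>) (range \<alpha>) (range \<beta>)"
    using bij by (intro bij_betw_trans[OF bij_betw_inv_into]) auto
  then show ?thesis
    unfolding alg_iso_def
    by (intro exI[of _ "\<beta> \<circ> inv \<alpha>"])
      (auto simp: hom inv \<beta>.add \<beta>.scale simp flip: \<alpha>.add \<alpha>.scale)
qed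

lemma alg_iso_UNIV_imp_embedding:
  assumes "alg_iso \<nu> UNIV br N"
  obtains f where "algebra_embedding f \<nu> br" "range f = N"
proof -
  obtain f where "bij_betw f UNIV N" "\<forall>x y. f (x + y) = f x + f y"
    "\<forall>c x. f (c *s x) = c *s f x" "\<forall>x y. f (\<nu> x y) = br (f x) (f y)"
    using assms unfolding alg_iso_def by auto
  then show thesis
    by (intro that[of f])
      (auto simp: algebra_embedding_def Vector_Spaces.linear_iff vec.vector_space_axioms bij_betw_def)
qed

lemma embedding_dim_range:
  assumes "Vector_Spaces.linear (*s) (*s) \<tau>" "inj \<tau>"
  shows "vec.dim (range (\<tau> :: complex ^ 's \<Rightarrow> complex ^ 'n)) = CARD('s)"
  using vec.dim_image_eq[OF assms(1), of UNIV] assms(2) by (simp add: vec_dim_card card_cart_basis)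

section \<open>Structures near a given one\<close>

text \<open>The map \<open>\<tau> br\<close> sends the standard basis to \<open>CARD('s)\<close> fixed brackets of coordinate vectors, chosen to form a basis
  of the derived algebra at \<open>R\<close>. They are columns of a matrix \<open>C br\<close> whose other columns are constant, and
  \<open>d\<close> is the determinant of \<open>C br\<close>. Where \<open>d\<close> is nonzero, Cramer's rule computes the coordinates
  of the products of these vectors, with numerators \<open>a\<close>. The last conclusion is restricted to the case that the range of
  \<open>\<tau> br\<close> contains all brackets: only then do these coordinates describe the products.\<close>
lemma rational_structure_on_derived_algebra:
  fixes R :: "('n::finite) bracket"
  assumes R: "R \<in> bilinear_brackets"
    and dim: "vec.dim (bracket_span R UNIV UNIV) = CARD('s::finite)"
  obtains d :: "('n \<times> 'n \<times> 'n \<Rightarrow> complex) \<Rightarrow> complex"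
    and a :: "'s::finite \<times> 's \<times> 's \<Rightarrow> ('n \<times> 'n \<times> 'n \<Rightarrow> complex) \<Rightarrow> complex"
    and \<tau> :: "'n bracket \<Rightarrow> complex ^ ('s::finite) \<Rightarrow> complex ^ 'n"
  where "polynomial_fun d" "\<And>i. polynomial_fun (a i)" "d (struct_const R) \<noteq> 0"
    and "\<And>br. br \<in> bilinear_brackets \<Longrightarrow> d (struct_const br) \<noteq> 0 \<Longrightarrow>
      Vector_Spaces.linear (*s) (*s) (\<tau> br) \<and> inj (\<tau> br) \<and> range (\<tau> br) \<subseteq> bracket_span br UNIV UNIV"
    and "\<And>br. br \<in> bilinear_brackets \<Longrightarrow> d (struct_const br) \<noteq> 0 \<Longrightarrow> 
      (\<And>x y. br x y \<in> range (\<tau> br)) \<Longrightarrow>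
      algebra_embedding (\<tau> br) (bracket_of (\<lambda>i. a i (struct_const br) / d (struct_const br))) br"
proof -
  define w where "w br = (\<lambda>(p, q). br (axis p 1) (axis q 1))" for br :: "'n bracket"
  obtain S idx c where det: "det (\<chi> i. if i \<in> S then w R (idx i) else c i) \<noteq> 0"
    and card: "card S = vec.dim (range (w R))"
    by (rule complete_to_invertible[of "w R"])
  have "vec.dim (range (w R)) = vec.dim (bracket_span R UNIV UNIV)"
    unfolding bracket_span_eq_span_axis[OF R] vec.dim_span w_def ..
  then have "card S = CARD('s)"
    using card dim by simp
  then obtain \<iota> :: "'s \<Rightarrow> 'n" where \<iota>: "bij_betw \<iota> UNIV S"
    using finite_same_card_bij[of "UNIV :: 's set" S] by auto
  then have \<iota>_S: "\<iota> k \<in> S" and \<iota>_inj: "\<iota> k = \<iota> l \<longleftrightarrow> k = l" for k l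
    by (auto simp: bij_betw_def inj_eq)
  define C where "C br = transpose (\<chi> i. if i \<in> S then w br (idx i) else c i)" for br
  define u where "u br k = w br (idx (\<iota> k))" for br k
  define \<tau> where "\<tau> br x = (\<Sum>k\<in>UNIV. x $ k *s u br k)" for br and x :: "complex ^ 's"
  define replace where "replace br k b = (\<chi> p q. if q = \<iota> k then b $ p else C br $ p $ q)"
    for br k and b :: "complex ^ 'n"
  define d where "d v = det (C (bracket_of v))" for v
  define a where "a = (\<lambda>(i, j, k) v.
    det (replace (bracket_of v) k (bracket_of v (u (bracket_of v) i) (u (bracket_of v) j))))"
  have sc: "bracket_of (struct_const br) = br" if "br \<in> bilinear_brackets" for br :: "'n bracket"
    using that by (intro bilinear_bracket.bracket_of_struct_const bilinear_bracket.intro)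
  have w_poly: "polynomial_fun (\<lambda>v. w (bracket_of v) t $ p)" for t p
    by (cases t) (simp add: w_def polynomial_fun_bracket_of polynomial_fun.const)
  have C_poly: "polynomial_fun (\<lambda>v. C (bracket_of v) $ p $ q)" for p q
    by (cases "q \<in> S") (simp_all add: C_def transpose_def w_poly polynomial_fun.const)
  have d_poly: "polynomial_fun d"
    unfolding d_def by (intro polynomial_fun_det C_poly)
  have u_poly: "polynomial_fun (\<lambda>v. u (bracket_of v) k $ p)" for k p
    by (simp add: u_def w_poly)
  have a_poly: "polynomial_fun (a t)" for t
  proof -
    obtain i j k where t: "t = (i, j, k)"
      by (cases t)
    let ?b = "\<lambda>v. bracket_of v (u (bracket_of v) i) (u (bracket_of v) j)"
    have "polynomial_fun (\<lambda>v. replace (bracket_of v) k (?b v) $ p $ q)" for p q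
      by (cases "q = \<iota> k") (simp_all add: replace_def C_poly polynomial_fun_bracket_of u_poly)
    then show ?thesis
      unfolding a_def t prod.case by (intro polynomial_fun_det)
  qed
  have u_C: "u br k = C br *v axis (\<iota> k) 1" for br k
    by (simp add: u_def C_def transpose_def matrix_vector_mult_axis \<iota>_S vec_eq_iff)
  have \<tau>_lin: "Vector_Spaces.linear (*s) (*s) (\<tau> br)" for br
    unfolding Vector_Spaces.linear_iff \<tau>_def
    by (simp add: vec.vector_space_axioms vec.scale_left_distrib sum.distrib vec.scale_sum_right)
  have \<tau>_axis: "\<tau> br (axis k 1) = u br k" for br k
  proof -
    have "axis k 1 $ l *s u br l = (if l = k then u br k else 0)" for l
      by (simp add: axis_def)
    then show ?thesis
      by (simp add: \<tau>_def)
  qed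
  have coord: "x $ k = det (replace br k (\<tau> br x)) / det (C br)" if nz: "det (C br) \<noteq> 0" for br x k
  proof -
    let ?z = "\<Sum>l\<in>UNIV. x $ l *s axis (\<iota> l) (1 :: complex)"
    have "C br *v ?z = \<tau> br x"
      by (simp add: \<tau>_def vec.sum vec.scale u_C)
    then have "?z = (\<chi> q. det (\<chi> i j. if j = q then \<tau> br x $ i else C br $ i $ j) / det (C br))"
      using cramer[OF nz] by blast
    then have "?z $ \<iota> k = det (replace br k (\<tau> br x)) / det (C br)"
      by (simp add: replace_def)
    moreover have "(x $ l *s axis (\<iota> l) (1 :: complex)) $ \<iota> k = (if l = k then x $ k else 0)" for l
      by (simp add: axis_def \<iota>_inj)
    then have "?z $ \<iota> k = x $ k"
      by simp
    ultimately show ?thesis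
      by simp
  qed
  show thesis
  proof (rule that[OF d_poly a_poly])
    show "d (struct_const R) \<noteq> 0"
      using det by (simp add: d_def sc[OF R] C_def det_transpose)
    fix br :: "'n bracket" assume br: "br \<in> bilinear_brackets" and "d (struct_const br) \<noteq> 0"
    then have nz: "det (C br) \<noteq> 0"
      by (simp add: d_def sc)
    have "inj (\<tau> br)"
      by (rule injI) (metis coord[OF nz] vec_eq_iff)
    moreover have "range (\<tau> br) \<subseteq> bracket_span br UNIV UNIV"
      unfolding \<tau>_def u_def w_def bracket_span_eq_span_axis[OF br]
      by (intro image_subsetI vec.span_sum vec.span_scale vec.span_base rangeI)
    ultimately show "Vector_Spaces.linear (*s) (*s) (\<tau> br) \<and> inj (\<tau> br) \<and> range (\<tau> br) \<subseteq> bracket_span br UNIV UNIV"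
      using \<tau>_lin by blast
    assume closed: "\<And>x y. br x y \<in> range (\<tau> br)"
    interpret bilinear_bracket br
      using br by unfold_locales
    interpret \<tau>: Vector_Spaces.linear "(*s)" "(*s)" "\<tau> br"
      by (rule \<tau>_lin)
    let ?\<nu> = "bracket_of (\<lambda>i. a i (struct_const br) / d (struct_const br))"
    have basis: "\<tau> br (\<chi> k. a (i, j, k) (struct_const br) / d (struct_const br)) = br (u br i) (u br j)" for i j
    proof -
      obtain z where z: "br (u br i) (u br j) = \<tau> br z"
        using closed[of "u br i" "u br j"] by blast
      have "z $ k = a (i, j, k) (struct_const br) / d (struct_const br)" for k
        unfolding coord[OF nz, of z k] by (simp add: a_def d_def sc[OF br] z)
      then have "(\<chi> k. a (i, j, k) (struct_const br) / d (struct_const br)) = z"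
        by (simp add: vec_eq_iff)
      then show ?thesis
        using z by simp
    qed
    have "\<tau> br (?\<nu> x y) = br (\<tau> br x) (\<tau> br y)" for x y
    proof -
      have "?\<nu> x y = (\<Sum>i\<in>UNIV. \<Sum>j\<in>UNIV. (x $ i * y $ j) *s (\<chi> k. a (i, j, k) (struct_const br) / d (struct_const br)))"
        by (simp add: vec_eq_iff bracket_of_def)
      then have "\<tau> br (?\<nu> x y) = (\<Sum>i\<in>UNIV. \<Sum>j\<in>UNIV. (x $ i * y $ j) *s br (u br i) (u br j))"
        by (simp only: \<tau>.sum \<tau>.scale basis)
      also have "\<dots> = br (\<tau> br x) (\<tau> br y)"
        unfolding \<tau>_def sum_left sum_right scale_left scale_right vec.scale_sum_right vec.scale_scale
        by (subst sum.swap) (simp add: mult.commute)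
      finally show ?thesis .
    qed
    then show "algebra_embedding (\<tau> br) ?\<nu> br"
      using \<open>inj (\<tau> br)\<close> \<tau>_lin by (simp add: algebra_embedding_def)
  qed
qed

lemma degeneration_generic_point:
  assumes "degenerates_to R\<^sub>1 R" and R: "R \<in> bilinear_brackets"
    and q: "polynomial_fun q" "q (struct_const R) \<noteq> 0"
  obtains g where "invertible g" "q (struct_const (gl_act g R\<^sub>1)) \<noteq> 0"
proof -
  have "gl_act (mat 1) R = R"
  proof -
    have "invertible (mat 1 :: complex ^ 'a ^ 'a)"
      by (auto simp: invertible_def intro: exI[of _ "mat 1"])
    from matrix_inv_mult(2)[OF this] have "matrix_inv (mat 1 :: complex ^ 'a ^ 'a) = mat 1"
      by simp
    then show ?thesis
      by (simp add: gl_act_def)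
  qed
  then have "R \<in> gl_orbit R"
    unfolding gl_orbit_def by (auto simp: invertible_def intro!: exI[of _ "mat 1"])
  then have "R \<in> zariski closure_of gl_orbit R\<^sub>1"
    using assms(1) by (auto simp: degenerates_to_def)
  moreover have "openin zariski (bilinear_brackets - zero_locus {q})"
  proof -
    have "bilinear_brackets - (bilinear_brackets - zero_locus {q}) = zero_locus {q}"
      by (auto simp: zero_locus_def)
    then show ?thesis
      unfolding openin_zariski zariski_closed_def using q(1) by auto
  qed
  moreover have "R \<in> bilinear_brackets - zero_locus {q}"
    using R q(2) by (simp add: zero_locus_def)
  ultimately obtain y where "y \<in> gl_orbit R\<^sub>1" "y \<in> bilinear_brackets - zero_locus {q}"
    unfolding in_closure_of by blast
  then show thesis
    using that by (auto simp: gl_orbit_def zero_locus_def)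
qed

text \<open>An open set of nilpotent structures contains, around each of its points, a basic open set given by the
  nonvanishing of one polynomial.\<close>
lemma rigid_nilpotent_polynomial_neighbourhood:
  assumes rigid: "rigid_nilpotent \<nu>" and "\<nu>' \<in> gl_orbit \<nu>"
  obtains p where "polynomial_fun p" "p (struct_const \<nu>') \<noteq> 0"
    and "\<And>\<nu>''. \<nu>'' \<in> LN \<Longrightarrow> p (struct_const \<nu>'') \<noteq> 0 \<Longrightarrow> \<nu>'' \<in> gl_orbit \<nu>"
proof -
  obtain U where U: "openin zariski U" "gl_orbit \<nu> = U \<inter> LN"
    using rigid unfolding rigid_nilpotent_def openin_subtopology by blast
  then obtain P where P: "Ball P polynomial_fun" "bilinear_brackets - U = zero_locus P"
    unfolding openin_zariski zariski_closed_def by blast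
  have "\<nu>' \<in> U" "\<nu>' \<in> bilinear_brackets"
    using assms(2) U openin_zariski by blast+
  then have "\<nu>' \<notin> zero_locus P"
    using P(2) by blast
  then obtain p where p: "p \<in> P" "p (struct_const \<nu>') \<noteq> 0"
    using \<open>\<nu>' \<in> bilinear_brackets\<close> by (auto simp: zero_locus_def)
  show thesis
  proof (rule that)
    show "polynomial_fun p" "p (struct_const \<nu>') \<noteq> 0"
      using p P(1) by auto
    fix \<nu>'' assume \<nu>'': "\<nu>'' \<in> LN" "p (struct_const \<nu>'') \<noteq> 0"
    then have "\<nu>'' \<in> bilinear_brackets" "\<nu>'' \<notin> zero_locus P"
      using p(1) by (auto simp: LN_def Leib_def zero_locus_def)
    then have "\<nu>'' \<in> U"
      using P(2) by blast
    then show "\<nu>'' \<in> gl_orbit \<nu>"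
      using \<nu>'' U(2) by blast
  qed
qed

section \<open>Solvable degenerations onto a structure with rigid nilradical\<close>

theorem proposition3p5:
  fixes R R\<^sub>1 :: "('n::finite) bracket"
    and N :: "(complex ^ 'n) set"
    and \<nu> :: "('s::finite) bracket"
  assumes "R \<in> LR"
    and "is_nilradical R N"
    and "alg_iso \<nu> UNIV R N"
    and "rigid_nilpotent \<nu>"
    and "bracket_span R UNIV UNIV = N"
    and "R\<^sub>1 \<in> LR"
    and "degenerates_to R\<^sub>1 R"
  shows "R\<^sub>1 \<in> LR_nil R N"
proof -
  have R: "R \<in> bilinear_brackets" "R \<in> Leib" "solvable_alg R UNIV"
    and R1: "R\<^sub>1 \<in> bilinear_brackets" "R\<^sub>1 \<in> Leib" "solvable_alg R\<^sub>1 UNIV"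
    using assms(1,6) by (auto simp: LR_def Leib_def)
  interpret R: leibniz R
    using R by (simp add: leibniz_iff)
  have N: "trace_radical R = N"
    using R.nilradical_unique[OF R.is_nilradical_trace_radical[OF R(3)] assms(2)] .
  obtain f where f: "algebra_embedding f \<nu> R" "range f = N"
    by (rule alg_iso_UNIV_imp_embedding[OF assms(3)])
  then have dim_N: "vec.dim N = CARD('s)"
    using embedding_dim_range[of f] by (auto simp: algebra_embedding_def)
  obtain q where q: "polynomial_fun q" "q (struct_const R) \<noteq> 0"
    and small: "\<And>br. br \<in> bilinear_brackets \<Longrightarrow> q (struct_const br) \<noteq> 0 \<Longrightarrow>
      vec.dim (trace_radical br) \<le> vec.dim (trace_radical R)"
    using dim_trace_radical_semicontinuous[OF R(1)] by blast
  have "vec.dim (bracket_span R UNIV UNIV) = CARD('s)"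
    using dim_N assms(5) by simp
  from rational_structure_on_derived_algebra[OF R(1) this]
  obtain d a and \<tau> :: "'n bracket \<Rightarrow> complex ^ 's \<Rightarrow> complex ^ 'n"
    where da: "polynomial_fun d" "\<And>i. polynomial_fun (a i)" "d (struct_const R) \<noteq> 0"
      and \<tau>: "\<And>br. br \<in> bilinear_brackets \<Longrightarrow> d (struct_const br) \<noteq> 0 \<Longrightarrow>
        Vector_Spaces.linear (*s) (*s) (\<tau> br) \<and> inj (\<tau> br) \<and> range (\<tau> br) \<subseteq> bracket_span br UNIV UNIV"
      and emb: "\<And>br. br \<in> bilinear_brackets \<Longrightarrow> d (struct_const br) \<noteq> 0 \<Longrightarrow> 
        (\<And>x y. br x y \<in> range (\<tau> br)) \<Longrightarrow>
        algebra_embedding (\<tau> br) (bracket_of (\<lambda>i. a i (struct_const br) / d (struct_const br))) br"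
    by metis
  define coords where "coords br = (\<lambda>i. a i (struct_const br) / d (struct_const br))" for br
  \<comment> \<open>The range lies in the derived algebra, hence in the trace radical, and has dimension \<open>s\<close>.\<close>
  have range_\<tau>: "range (\<tau> br) = trace_radical br"
    if br: "br \<in> LR" "d (struct_const br) \<noteq> 0" "vec.dim (trace_radical br) \<le> CARD('s)" for br
  proof -
    interpret leibniz br
      using br by (simp add: leibniz_iff LR_def)
    have solv: "solvable_alg br UNIV"
      using br by (simp add: LR_def)
    have sub: "vec.subspace (trace_radical br)"
      using is_nilradical_trace_radical[OF solv] by (simp add: is_nilradical_def leibniz_ideal_def)
    have "bracket_span br UNIV UNIV \<subseteq> trace_radical br"
      by (intro bracket_span_subset sub bracket_in_trace_radical solv)
    then have "range (\<tau> br) \<subseteq> trace_radical br"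
      using \<tau>[OF bilinear br(2)] by blast
    moreover have "vec.subspace (range (\<tau> br))" "vec.dim (range (\<tau> br)) = CARD('s)"
      using \<tau>[OF bilinear br(2)] embedding_dim_range[of "\<tau> br"] vec.linear_subspace_image[of "\<tau> br" UNIV]
      by auto
    ultimately show ?thesis
      using vec.subspace_dim_equal sub br(3) by metis
  qed
  have emb': "algebra_embedding (\<tau> br) (bracket_of (coords br)) br"
    if br: "br \<in> LR" "d (struct_const br) \<noteq> 0" "vec.dim (trace_radical br) \<le> CARD('s)" for br
  proof -
    interpret leibniz br
      using br by (simp add: leibniz_iff LR_def)
    show ?thesis
      unfolding coords_def
    proof (rule emb[OF bilinear br(2)])
      show "br x y \<in> range (\<tau> br)" for x y
        using br bracket_in_trace_radical range_\<tau> by (simp add: LR_def)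
    qed
  qed
  have "range (\<tau> R) = range f"
    using range_\<tau>[OF assms(1) da(3)] N f(2) dim_N by simp
  then have "bracket_of (coords R) \<in> gl_orbit \<nu>"
    using embeddings_same_range_imp_orbit[OF f(1) emb'[OF assms(1) da(3)]] N dim_N by simp
  then obtain p where p: "polynomial_fun p" "p (struct_const (bracket_of (coords R))) \<noteq> 0"
    and p_orbit: "\<And>\<nu>''. \<nu>'' \<in> LN \<Longrightarrow> p (struct_const \<nu>'') \<noteq> 0 \<Longrightarrow> \<nu>'' \<in> gl_orbit \<nu>"
    using rigid_nilpotent_polynomial_neighbourhood[OF assms(4)] by metis
  obtain r m where r: "polynomial_fun r" "\<And>v. d v \<noteq> 0 \<Longrightarrow> r v = d v ^ m * p (\<lambda>i. a i v / d v)"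
    using polynomial_fun_clear_denominator[OF p(1), where a = a and d = d, OF da(2) da(1)] by blast
  \<comment> \<open>\<open>q\<close> bounds the nilradical, \<open>d\<close> keeps its basis independent, and \<open>r\<close> places its isomorphism
    class in the orbit of \<open>\<nu>\<close>.\<close>
  let ?Q = "\<lambda>v. q v * (d v * r v)"
  have "polynomial_fun ?Q"
    using q da r by (intro polynomial_fun.mult)
  moreover have "?Q (struct_const R) \<noteq> 0"
    using q da(3) r(2) p(2) by (simp add: struct_const_bracket_of coords_def)
  ultimately obtain g where g: "invertible g" "?Q (struct_const (gl_act g R\<^sub>1)) \<noteq> 0"
    by (rule degeneration_generic_point[OF assms(7) R(1)])
  define br where "br = gl_act g R\<^sub>1"
  define \<psi> where "\<psi> = (*v) (matrix_inv g)"
  have \<psi>: "algebra_embedding \<psi> br R\<^sub>1" "surj \<psi>"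
    unfolding \<psi>_def br_def using gl_act_embedding[OF g(1)] by auto
  have br_bil: "br \<in> bilinear_brackets"
    unfolding br_def by (rule gl_act_bilinear[OF R1(1)])
  then have br_LR: "br \<in> LR"
    using embedding_into_Leib[OF \<psi>(1) R1(2)] embedding_solvable_iff[OF \<psi>(1), of UNIV] \<psi>(2) R1(3)
    by (simp add: LR_def)
  interpret br: leibniz br
    using br_LR by (simp add: leibniz_iff LR_def)
  have nz: "q (struct_const br) \<noteq> 0" "d (struct_const br) \<noteq> 0" "r (struct_const br) \<noteq> 0"
    using g(2) by (auto simp: br_def)
  have dim_br: "vec.dim (trace_radical br) \<le> CARD('s)"
    using small[OF br_bil nz(1)] N dim_N by simp
  note \<tau>_br = emb'[OF br_LR nz(2) dim_br] and range_br = range_\<tau>[OF br_LR nz(2) dim_br]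
  have nilrad: "is_nilradical br (trace_radical br)"
    using br.is_nilradical_trace_radical br_LR by (simp add: LR_def)
  have "bracket_of (coords br) \<in> LN"
    using embedding_into_Leib[OF \<tau>_br] embedding_nilpotent_iff[OF \<tau>_br, of UNIV] br_LR nilrad
    by (simp add: LN_def LR_def range_br is_nilradical_def bracket_of_bilinear)
  moreover have "p (struct_const (bracket_of (coords br))) \<noteq> 0"
    using nz r(2) by (auto simp: struct_const_bracket_of coords_def)
  ultimately have "bracket_of (coords br) \<in> gl_orbit \<nu>"
    by (rule p_orbit)
  then obtain g' where g': "invertible g'" "bracket_of (coords br) = gl_act g' \<nu>"
    by (auto simp: gl_orbit_def)
  define \<theta> where "\<theta> = (*v) (matrix_inv g')"
  have \<theta>: "algebra_embedding \<theta> (bracket_of (coords br)) \<nu>" "surj \<theta>"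
    unfolding \<theta>_def g'(2) by (rule gl_act_embedding[OF g'(1)])+
  have "alg_iso R\<^sub>1 (range (\<psi> \<circ> \<tau> br)) R (range (f \<circ> \<theta>))"
    by (rule alg_iso_ranges[OF algebra_embedding_compose[OF \<tau>_br \<psi>(1)]
          algebra_embedding_compose[OF \<theta>(1) f(1)]])
  moreover have "range (f \<circ> \<theta>) = N"
    using \<theta>(2) f(2) unfolding image_comp[symmetric] by simp
  moreover have "is_nilradical R\<^sub>1 (range (\<psi> \<circ> \<tau> br))"
    using nilradical_image[OF \<psi> nilrad] unfolding image_comp[symmetric] range_br .
  ultimately show ?thesis
    using assms(6) by (auto simp: LR_nil_def)
qed

end
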